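(* Let $r\ge1$ and $n\ge 1$, and let $\det:\mathrm{GL}_r\to\mathbb G_m$ be the determinant. Pullback along $\det$ induces a bijection \[ \det{}^*:\{\text{invariant algebraic } D\text{-modules of rank } n \text{ on } \mathbb G_m\}/\!\sim\;\longrightarrow\;\{\text{invariant algebraic } D\text{-modules of rank } n \text{ on } \mathrm{GL}_r\}/\!\sim, \] where $\sim$ denotes isomorphism of $D$-modules.
   Context: For a complex affine algebraic group $G$, an invariant algebraic $D$-module of rank $n$ on $G$ is a $\mathcal D_G$-module $M_\alpha$ where $\alpha$ is an $n\times n$ matrix of left-invariant Kähler $1$-forms on $G$ satisfying $d\alpha+\alpha\wedge\alpha=0$, and $M_\alpha$ is $\mathbb C[G]^{\oplus n}$ with vector fields acting on the standard basis by $v(e_1,\dots,e_n)=(e_1,\dots,e_n)\alpha(v)$, extended by the Leibniz rule; i.e. the flat connection $d+\alpha$ on the trivial rank-$n$ bundle. Pullback along the homomorphism $\det$ sends the connection $d+\alpha$ on $\mathbb G_m$ to $d+\det^*\alpha$ on $\mathrm{GL}_r$, which is again invariant and flat. *)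

theory Defs
  imports "HOL-Analysis.Analysis"
begin

text \<open>Complex r x r matrices, indexed by a finite type 'r (so r = CARD('r) \<ge> 1).
  GL_r is realised as the invertible matrices; G_m is GL_1 (index type 1).\<close>

type_synonym 'r cmat = "complex^'r^'r"

definition GL :: "('r::finite) cmat set" where
  "GL = {g. det g \<noteq> 0}"

text \<open>Regular functions on GL_r: the algebra C[x_ij, det^-1], realised as functions
  on matrices (only their values on GL matter).\<close>
inductive_set regular_fn :: "(('r::finite) cmat \<Rightarrow> complex) set" where
  const: "(\<lambda>g. c) \<in> regular_fn"
| coord: "(\<lambda>g. g $ i $ j) \<in> regular_fn"
| invdet: "(\<lambda>g. inverse (det g)) \<in> regular_fn"
| add: "f \<in> regular_fn \<Longrightarrow> h \<in> regular_fn \<Longrightarrow> (\<lambda>g. f g + h g) \<in> regular_fn"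
| mult: "f \<in> regular_fn \<Longrightarrow> h \<in> regular_fn \<Longrightarrow> (\<lambda>g. f g * h g) \<in> regular_fn"

definition msc :: "complex \<Rightarrow> ('r::finite) cmat \<Rightarrow> 'r cmat" where
  "msc c A = (\<chi> i j. c * A $ i $ j)"

text \<open>The left-invariant vector field X_A (A in gl_r) acting on a function:
  (X_A f)(g) = d/dt f(g (1 + tA)) at t = 0.\<close>
definition inv_vf :: "('r::finite) cmat \<Rightarrow> ('r cmat \<Rightarrow> complex) \<Rightarrow> 'r cmat \<Rightarrow> complex" where
  "inv_vf A f g = deriv (\<lambda>t. f (g + msc t (g ** A))) 0"

text \<open>An n x n matrix of left-invariant Kaehler 1-forms on GL_r is a C-linear map
  alpha : gl_r \<rightarrow> gl_n (its values on the left-invariant vector fields X_A).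
  Flatness d alpha + alpha \<and> alpha = 0, evaluated on (X_A, X_B), using that alpha(X_B)
  is constant and [X_A, X_B] = X_(AB - BA), reads alpha(AB-BA) = [alpha A, alpha B].\<close>
definition invariant_conn :: "(('r::finite) cmat \<Rightarrow> ('n::finite) cmat) \<Rightarrow> bool" where
  "invariant_conn \<alpha> \<longleftrightarrow>
     (\<forall>A B. \<alpha> (A + B) = \<alpha> A + \<alpha> B) \<and>
     (\<forall>c A. \<alpha> (msc c A) = msc c (\<alpha> A)) \<and>
     (\<forall>A B. \<alpha> (A ** B - B ** A) = \<alpha> A ** \<alpha> B - \<alpha> B ** \<alpha> A)"

text \<open>Isomorphism of D-modules M_alpha \<rightarrow> M_beta: a C[G]-linear automorphism of C[G]^n,
  i.e. a matrix Phi over C[G] invertible over C[G], commuting with the action of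
  (left-invariant, hence by C[G]-linearity all) vector fields:
  X_A(Phi) + beta(A) Phi = Phi alpha(A).\<close>
definition D_iso :: "(('r::finite) cmat \<Rightarrow> ('n::finite) cmat) \<Rightarrow> ('r cmat \<Rightarrow> 'n cmat) \<Rightarrow> bool" where
  "D_iso \<alpha> \<beta> \<longleftrightarrow>
     (\<exists>\<Phi> \<Psi> :: 'n \<Rightarrow> 'n \<Rightarrow> ('r cmat \<Rightarrow> complex).
        (\<forall>k l. \<Phi> k l \<in> regular_fn \<and> \<Psi> k l \<in> regular_fn) \<and>
        (\<forall>g\<in>GL. (\<chi> k l. \<Phi> k l g) ** (\<chi> k l. \<Psi> k l g) = mat 1 \<and>
                 (\<chi> k l. \<Psi> k l g) ** (\<chi> k l. \<Phi> k l g) = mat 1) \<and>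
        (\<forall>A. \<forall>g\<in>GL. (\<chi> k l. inv_vf A (\<Phi> k l) g) + \<beta> A ** (\<chi> k l. \<Phi> k l g)
                      = (\<chi> k l. \<Phi> k l g) ** \<alpha> A))"

text \<open>Pullback of left-invariant forms along the homomorphism det : GL_r \<rightarrow> G_m = GL_1:
  (det^* alpha)(A) = alpha(d det_1 (A)), with d det_1(A) = d/dt det(1 + tA) at 0.\<close>
definition det_pullback :: "(1 cmat \<Rightarrow> ('n::finite) cmat) \<Rightarrow> (('r::finite) cmat \<Rightarrow> 'n cmat)" where
  "det_pullback \<alpha> A = \<alpha> (\<chi> i j. deriv (\<lambda>t. det (mat 1 + msc t A)) 0)"

end

theory Submission
  imports Defs
begin

text \<open>For surjectivity fix an index \<open>k\<close>, let \<open>E\<close> be the matrix unit at \<open>(k, k)\<close> and take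
  \<open>\<alpha>(c) = c \<beta>(E)\<close>. If \<open>\<rho>\<close> is a polynomial map on \<open>SL_r\<close> integrating the restriction of \<open>\<beta>\<close> to
  traceless matrices, then \<open>\<Phi>(g) = \<rho>(s(det g)\<^sup>-\<^sup>1 g)\<^sup>-\<^sup>1\<close> with \<open>s(c) = diag(1, \<dots>, c, \<dots>, 1)\<close> is an
  isomorphism from \<open>det\<^sup>* \<alpha>\<close> to \<open>\<beta>\<close>.

  The map \<open>\<rho>\<close> is built by induction on the size. Where the corner entry is nonzero, Gaussian
  elimination writes \<open>g\<close> as a product of elementary matrices and an element of a smaller \<open>SL\<close>;
  elementary matrices integrate to polynomials because \<open>\<beta>\<close> sends them to nilpotents. Left translates
  of this solution cover \<open>SL_r\<close>. Any two of them agree on their common domain, since a complex line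
  minus finitely many points is connected, and they glue to a polynomial because the corner entries
  generate the unit ideal. Injectivity follows by restricting along the section \<open>s\<close>.\<close>

subsection \<open>Matrices over the complex numbers and their derivatives\<close>

text \<open>Only traceless matrices are integrated because in the determinant direction solutions
  need not be algebraic: already in size 1 they look like powers c^lambda with lambda complex.
  \<open>E\<close> has trace 1 and is tangent to s, which splits det algebraically; a splitting by
  scalar matrices would need an r-th root. On SL_r, algebraicity is usually drawn from integral
  weights and simple connectedness. Here the torus is itself written in elementary matrices, whose
  exponentials are finite sums, and any two charts are compared along curves from the identity. The
  equation for \<rho> is tested along complex curves only, so products of solutions need just the
  one-variable product rule. The price is that each value must be known to intertwine \<beta> with
  conjugation (\<open>adm\<close>). The contragredient of \<beta> is integrated alongside: its
  transposed solution inverts \<rho>, which gives both uniqueness and a polynomial inverse.\<close>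

lemma msc_nth [simp]: "msc c A $ i $ j = c * A $ i $ j"
  by (simp add: msc_def)

lemma matrix_diff_ldistrib: "(A :: complex^'m^'n) ** (B - C) = A ** B - A ** C"
  by (simp add: vec_eq_iff matrix_matrix_mult_def sum_subtractf algebra_simps)

lemma matrix_add_rdistrib: "(B + C) ** (A :: complex^'m^'n) = B ** A + C ** A"
  by (simp add: vec_eq_iff matrix_matrix_mult_def sum.distrib algebra_simps)

lemma matrix_diff_rdistrib: "(B - C) ** (A :: complex^'m^'n) = B ** A - C ** A"
  by (simp add: vec_eq_iff matrix_matrix_mult_def sum_subtractf algebra_simps)

lemma matrix_minus_left: "(- B) ** (A :: complex^'m^'n) = - (B ** A)"
  by (simp add: vec_eq_iff matrix_matrix_mult_def sum_negf)

lemma matrix_minus_right: "B ** (- A :: complex^'m^'n) = - (B ** A)"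
  by (simp add: vec_eq_iff matrix_matrix_mult_def sum_negf)

lemma matrix_zero_left [simp]: "0 ** (A :: complex^'m^'n) = 0"
  by (simp add: vec_eq_iff matrix_matrix_mult_def)

lemma matrix_zero_right [simp]: "(A :: complex^'m^'n) ** 0 = 0"
  by (simp add: vec_eq_iff matrix_matrix_mult_def)

lemma msc_mult_left: "msc c A ** B = msc c (A ** B)"
  by (simp add: vec_eq_iff matrix_matrix_mult_def sum_distrib_left mult_ac)

lemma msc_mult_right: "A ** msc c B = msc c (A ** B)"
  by (simp add: vec_eq_iff matrix_matrix_mult_def sum_distrib_left mult_ac)

lemma msc_add: "msc c (A + B) = msc c A + msc c B"
  by (simp add: vec_eq_iff algebra_simps)

lemma msc_diff: "msc c (A - B) = msc c A - msc c B"
  by (simp add: vec_eq_iff algebra_simps)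

lemma msc_minus: "msc c (- A) = - msc c A"
  by (simp add: vec_eq_iff)

lemma msc_one [simp]: "msc 1 A = A"
  and msc_zero [simp]: "msc 0 A = 0"
  and msc_zero_right [simp]: "msc c 0 = 0"
  and msc_msc [simp]: "msc c (msc d A) = msc (c * d) A"
  by (simp_all add: vec_eq_iff)

lemma msc_add_left: "msc (c + d) A = msc c A + msc d A"
  by (simp add: vec_eq_iff algebra_simps)

lemmas mat_algebra =
  matrix_add_ldistrib matrix_add_rdistrib matrix_diff_ldistrib matrix_diff_rdistrib
  matrix_minus_left matrix_minus_right matrix_mul_assoc msc_mult_left msc_mult_right
  msc_add msc_diff msc_minus

section \<open>Entrywise complex derivatives of matrix-valued functions\<close>

definition mderiv :: "(complex \<Rightarrow> complex^'m^'n) \<Rightarrow> complex^'m^'n \<Rightarrow> complex \<Rightarrow> bool" where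
  "mderiv F D t \<longleftrightarrow> (\<forall>i j. ((\<lambda>s. F s $ i $ j) has_field_derivative D $ i $ j) (at t))"

lemma mderivI:
  "(\<And>i j. ((\<lambda>s. F s $ i $ j) has_field_derivative D $ i $ j) (at t)) \<Longrightarrow> mderiv F D t"
  by (simp add: mderiv_def)

lemma mderivD:
  "mderiv F D t \<Longrightarrow> ((\<lambda>s. F s $ i $ j) has_field_derivative D $ i $ j) (at t)"
  by (simp add: mderiv_def)

lemma mderiv_const: "mderiv (\<lambda>s. A) 0 t"
  by (simp add: mderiv_def)

lemma mderiv_add: "mderiv F D t \<Longrightarrow> mderiv G E t \<Longrightarrow> mderiv (\<lambda>s. F s + G s) (D + E) t"
  by (rule mderivI, simp only: vector_add_component, intro DERIV_add mderivD)

lemma mderiv_diff: "mderiv F D t \<Longrightarrow> mderiv G E t \<Longrightarrow> mderiv (\<lambda>s. F s - G s) (D - E) t"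
  by (rule mderivI, simp only: vector_minus_component, intro DERIV_diff mderivD)

lemma mderiv_mult:
  assumes "mderiv F D t" "mderiv G E t"
  shows "mderiv (\<lambda>s. F s ** G s) (D ** G t + F t ** E) t"
proof -
  have "((\<lambda>s. \<Sum>k\<in>UNIV. F s $ i $ k * G s $ k $ j) has_field_derivative
      (\<Sum>k\<in>UNIV. D $ i $ k * G t $ k $ j + E $ k $ j * F t $ i $ k)) (at t)" for i j
    using assms by (intro DERIV_sum DERIV_mult') (auto simp: mderiv_def algebra_simps
       intro!: DERIV_mult[THEN DERIV_cong])
  then show ?thesis
    by (simp add: mderiv_def matrix_matrix_mult_def sum.distrib mult_ac)
qed

lemma mderiv_msc:
  assumes "(f has_field_derivative f') (at t)" "mderiv F D t"
  shows "mderiv (\<lambda>s. msc (f s) (F s)) (msc f' (F t) + msc (f t) D) t"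
  using assms by (auto simp: mderiv_def mult_ac intro!: DERIV_mult[THEN DERIV_cong])

lemma mderiv_transpose: "mderiv F D t \<Longrightarrow> mderiv (\<lambda>s. transpose (F s)) (transpose D) t"
  by (rule mderivI) (simp add: transpose_def mderivD)

lemma mderiv_unique: "mderiv F D t \<Longrightarrow> mderiv F E t \<Longrightarrow> D = E"
  unfolding mderiv_def vec_eq_iff using DERIV_unique by blast

lemma mderiv_cong_ev:
  assumes "mderiv F D t" "\<forall>\<^sub>F s in nhds t. F s = G s"
  shows "mderiv G D t"
  unfolding mderiv_def
proof (intro allI)
  fix i j
  have "\<forall>\<^sub>F s in nhds t. F s $ i $ j = G s $ i $ j"
    using assms(2) by eventually_elim simp
  then show "((\<lambda>s. G s $ i $ j) has_field_derivative D $ i $ j) (at t)"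
    by (rule iffD1[OF DERIV_cong_ev[OF refl _ refl]]) (rule mderivD[OF assms(1)])
qed

lemma mderiv_imp_isCont: "mderiv F D t \<Longrightarrow> isCont (\<lambda>s. F s $ i $ j) t"
  by (auto simp: mderiv_def intro: DERIV_isCont)

text \<open>The complement of a finite subset of the complex line is connected, so there is no monodromy.\<close>

lemma mderiv_zero_imp_eq:
  assumes Z: "finite Z" "0 \<notin> Z" "1 \<notin> Z" and d: "\<And>z. z \<notin> Z \<Longrightarrow> mderiv F 0 z"
  shows "F 0 = F 1"
proof -
  have "F 0 $ i $ j = F 1 $ i $ j" for i j
  proof -
    have "connected (UNIV - Z :: complex set)"
      by (intro connected_open_delete_finite Z) auto
    moreover have "open (UNIV - Z)"
      using Z by (auto intro: open_Diff finite_imp_closed)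
    ultimately have "(\<lambda>z. F z $ i $ j) constant_on (UNIV - Z)"
      using d by (intro has_field_derivative_0_imp_constant_on) (auto simp: mderiv_def)
    then show ?thesis
      using Z unfolding constant_on_def by auto
  qed
  then show ?thesis
    by (simp add: vec_eq_iff)
qed

lemma matrix_left_imp_inv:
  fixes A B C :: "complex^'n^'n"
  assumes "A ** B = mat 1" "C ** B = mat 1"
  shows "A = C"
  using assms by (metis matrix_left_right_inverse matrix_mul_assoc matrix_mul_lid matrix_mul_rid)

lemma invertible_mult_matrix_inv:
  fixes A :: "complex^'n^'n"
  assumes "invertible A"
  shows "A ** matrix_inv A = mat 1" "matrix_inv A ** A = mat 1"
  using someI_ex[OF assms[unfolded invertible_def]] by (auto simp: matrix_inv_def)

subsection \<open>Polynomial functions of a matrix\<close>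

text \<open>Polynomial, regular, localised, one-variable polynomial and differentiable functions all
  satisfy this, so each matrix formula is checked once for all of them.\<close>

definition function_ring :: "('x \<Rightarrow> complex) set \<Rightarrow> bool" where
  "function_ring R \<longleftrightarrow> (\<forall>c. (\<lambda>x. c) \<in> R) \<and> (\<forall>f\<in>R. \<forall>h\<in>R. (\<lambda>x. f x + h x) \<in> R) \<and>
     (\<forall>f\<in>R. \<forall>h\<in>R. (\<lambda>x. f x * h x) \<in> R)"

lemma function_ringD:
  assumes "function_ring R"
  shows "(\<lambda>x. c) \<in> R"
    and "f \<in> R \<Longrightarrow> h \<in> R \<Longrightarrow> (\<lambda>x. f x + h x) \<in> R"
    and "f \<in> R \<Longrightarrow> h \<in> R \<Longrightarrow> (\<lambda>x. f x * h x) \<in> R"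
  using assms by (auto simp: function_ring_def)

lemma function_ring_minus:
  assumes "function_ring R" "f \<in> R"
  shows "(\<lambda>x. - f x) \<in> R"
  using function_ringD(3)[OF assms(1) function_ringD(1)[OF assms(1), of "-1"] assms(2)] by simp

lemma function_ring_diff:
  assumes "function_ring R" "f \<in> R" "h \<in> R"
  shows "(\<lambda>x. f x - h x) \<in> R"
  using function_ringD(2)[OF assms(1,2) function_ring_minus[OF assms(1,3)]] by simp

lemma function_ring_sum:
  assumes R: "function_ring R" and f: "\<And>k. k \<in> K \<Longrightarrow> f k \<in> R"
  shows "(\<lambda>x. \<Sum>k\<in>K. f k x) \<in> R"
  using f by (induction K rule: infinite_finite_induct) (auto intro: function_ringD[OF R])

lemma function_ring_prod:
  assumes R: "function_ring R" and f: "\<And>k. k \<in> K \<Longrightarrow> f k \<in> R"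
  shows "(\<lambda>x. \<Prod>k\<in>K. f k x) \<in> R"
  using f by (induction K rule: infinite_finite_induct) (auto intro: function_ringD[OF R])

lemma function_ring_power:
  assumes R: "function_ring R" and f: "f \<in> R"
  shows "(\<lambda>x. f x ^ n) \<in> R"
  using f by (induction n) (auto intro: function_ringD[OF R])

lemmas function_ring_intros = function_ringD function_ring_minus function_ring_diff
  function_ring_sum function_ring_prod function_ring_power

lemma function_ring_matrix_mult:
  assumes R: "function_ring R" and "\<And>i j. (\<lambda>x. F x $ i $ j) \<in> R" "\<And>i j. (\<lambda>x. G x $ i $ j) \<in> R"
  shows "(\<lambda>x. (F x ** G x) $ i $ j) \<in> R"
  using assms by (simp add: matrix_matrix_mult_def function_ring_intros)

lemma function_ring_det:
  assumes R: "function_ring R" and "\<And>i j. (\<lambda>x. F x $ i $ j) \<in> R"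
  shows "(\<lambda>x. det (F x)) \<in> R"
  using assms unfolding det_def by (intro function_ring_intros) auto

inductive_set polyfn :: "(('r::finite) cmat \<Rightarrow> complex) set" where
  const: "(\<lambda>g. c) \<in> polyfn"
| coord: "(\<lambda>g. g $ i $ j) \<in> polyfn"
| add: "f \<in> polyfn \<Longrightarrow> h \<in> polyfn \<Longrightarrow> (\<lambda>g. f g + h g) \<in> polyfn"
| mult: "f \<in> polyfn \<Longrightarrow> h \<in> polyfn \<Longrightarrow> (\<lambda>g. f g * h g) \<in> polyfn"

lemma polyfn_compose:
  assumes "f \<in> polyfn" "function_ring R" "\<And>i j. (\<lambda>x. \<phi> x $ i $ j) \<in> R"
  shows "(\<lambda>x. f (\<phi> x)) \<in> R"
  using assms(1) by induction (auto intro: function_ringD[OF assms(2)] assms(3))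

lemma function_ring_polyfn: "function_ring polyfn"
  by (auto simp: function_ring_def intro: polyfn.intros)

lemma function_ring_regular_fn: "function_ring regular_fn"
  by (auto simp: function_ring_def intro: regular_fn.intros)

lemma function_ring_poly: "function_ring {f. \<exists>q. f = poly q}"
  unfolding function_ring_def
proof (intro conjI allI ballI)
  show "(\<lambda>x. c) \<in> {f. \<exists>q. f = poly q}" for c :: complex
    by (auto intro!: exI[of _ "[:c:]"])
next
  fix f h :: "complex \<Rightarrow> complex"
  assume "f \<in> {f. \<exists>q. f = poly q}" "h \<in> {f. \<exists>q. f = poly q}"
  then obtain p q where "f = poly p" "h = poly q" by auto
  then have "(\<lambda>x. f x + h x) = poly (p + q)" "(\<lambda>x. f x * h x) = poly (p * q)" by auto
  then show "(\<lambda>x. f x + h x) \<in> {f. \<exists>q. f = poly q}" "(\<lambda>x. f x * h x) \<in> {f. \<exists>q. f = poly q}"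
    by blast+
qed

lemma function_ring_field_differentiable: "function_ring {f. f field_differentiable at t}"
  unfolding function_ring_def
  by (intro conjI allI ballI)
     (simp_all only: mem_Collect_eq field_differentiable_const field_differentiable_add
       field_differentiable_mult)

text \<open>The localisation of the polynomial ring at \<open>p\<close>. Functions are constrained
  only where \<open>p\<close> is nonzero, and a power of \<open>p\<close> clears the denominator,
  which is the form that gluing uses.\<close>

definition loc_polyfn :: "('r::finite cmat \<Rightarrow> complex) \<Rightarrow> ('r cmat \<Rightarrow> complex) set" where
  "loc_polyfn p = {F. \<exists>P\<in>polyfn. \<exists>N. \<forall>g. p g \<noteq> 0 \<longrightarrow> F g * p g ^ N = P g}"

lemma loc_polyfnI:
  "P \<in> polyfn \<Longrightarrow> (\<forall>g. p g \<noteq> 0 \<longrightarrow> F g * p g ^ N = P g) \<Longrightarrow> F \<in> loc_polyfn p"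
  unfolding loc_polyfn_def by blast

lemma polyfn_subset_loc: "f \<in> polyfn \<Longrightarrow> f \<in> loc_polyfn p"
  by (auto simp: loc_polyfn_def intro!: bexI[of _ f] exI[of _ 0])

lemma function_ring_loc_polyfn:
  assumes p: "p \<in> polyfn"
  shows "function_ring (loc_polyfn p)"
  unfolding function_ring_def
proof (intro conjI allI ballI)
  show "(\<lambda>x. c) \<in> loc_polyfn p" for c
    by (intro polyfn_subset_loc polyfn.intros)
next
  fix f h assume "f \<in> loc_polyfn p" "h \<in> loc_polyfn p"
  then obtain P M Q N where *: "P \<in> polyfn" "Q \<in> polyfn"
     "\<And>g. p g \<noteq> 0 \<Longrightarrow> f g * p g ^ M = P g" "\<And>g. p g \<noteq> 0 \<Longrightarrow> h g * p g ^ N = Q g"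
    unfolding loc_polyfn_def by blast
  have a: "(\<lambda>g. P g * p g ^ N + Q g * p g ^ M) \<in> polyfn" "(\<lambda>g. P g * Q g) \<in> polyfn"
    using p * by (auto intro!: function_ring_intros[OF function_ring_polyfn])
  have b: "\<forall>g. p g \<noteq> 0 \<longrightarrow> (f g + h g) * p g ^ (M + N) = P g * p g ^ N + Q g * p g ^ M"
    by (simp add: *(3,4)[symmetric] power_add algebra_simps)
  have c: "\<forall>g. p g \<noteq> 0 \<longrightarrow> (f g * h g) * p g ^ (M + N) = P g * Q g"
    by (simp add: *(3,4)[symmetric] power_add algebra_simps)
  show "(\<lambda>g. f g + h g) \<in> loc_polyfn p" "(\<lambda>g. f g * h g) \<in> loc_polyfn p"
    by (rule loc_polyfnI[OF a(1) b], rule loc_polyfnI[OF a(2) c])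
qed

lemma inverse_in_loc_polyfn: "(\<lambda>g. inverse (p g)) \<in> loc_polyfn p"
  by (auto simp: loc_polyfn_def intro!: bexI[of _ "\<lambda>g. 1"] exI[of _ 1] polyfn.const)

lemma loc_polyfn_compose:
  assumes "F \<in> loc_polyfn p" "\<And>i j. (\<lambda>g. \<phi> g $ i $ j) \<in> polyfn"
  shows "(\<lambda>g. F (\<phi> g)) \<in> loc_polyfn (\<lambda>g. p (\<phi> g))"
proof -
  obtain P N where P: "P \<in> polyfn" "\<forall>g. p g \<noteq> 0 \<longrightarrow> F g * p g ^ N = P g"
    using assms(1) unfolding loc_polyfn_def by blast
  have "(\<lambda>g. P (\<phi> g)) \<in> polyfn"
    by (intro polyfn_compose[OF P(1)] function_ring_polyfn assms)
  then show ?thesis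
    by (rule loc_polyfnI[where N = N]) (use P(2) in simp)
qed

text \<open>By Cramer's rule row \<open>a\<close> of the inverse consists of determinants of
  \<open>g\<close> with column \<open>a\<close> replaced by a unit vector. These cofactors witness
  that the entries of a column generate the unit ideal where the determinant is 1.\<close>

lemma matrix_inv_row_polyfn:
  "\<exists>u. (\<forall>i. u i \<in> polyfn) \<and> (\<forall>g::('r::finite) cmat. det g = 1 \<longrightarrow> (\<Sum>i\<in>UNIV. u i g * g $ i $ a) = 1)"
proof -
  define u where "u i g = det (\<chi> p q. if q = a then axis i 1 $ p else g $ p $ q)" for i and g :: "'r cmat"
  have "u i \<in> polyfn" for i
    unfolding u_def
    by (intro function_ring_det function_ring_polyfn)
       (case_tac "j = a"; simp add: polyfn.intros)
  moreover have "(\<Sum>i\<in>UNIV. u i g * g $ i $ a) = 1" if g: "det g = 1" for g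
  proof -
    have inv: "invertible g" using g by (simp add: invertible_det_nz)
    have "u i g = matrix_inv g $ a $ i" for i
    proof -
      have "g *v (column i (matrix_inv g)) = axis i 1"
        using invertible_mult_matrix_inv(1)[OF inv]
        by (simp add: vec_eq_iff matrix_vector_mult_def column_def matrix_matrix_mult_def mat_def axis_def)
      then have "column i (matrix_inv g) = (\<chi> k. det (\<chi> p q. if q = k then axis i 1 $ p else g $ p $ q) / det g)"
        using cramer[of g "column i (matrix_inv g)" "axis i 1"] g by simp
      then show ?thesis
        using g by (simp add: u_def vec_eq_iff column_def)
    qed
    then show ?thesis
      using invertible_mult_matrix_inv(2)[OF inv]
      by (simp add: vec_eq_iff matrix_matrix_mult_def mat_def)
  qed
  ultimately show ?thesis by (intro exI[of _ u] conjI allI impI)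
qed

subsection \<open>Representations of the matrix Lie algebra and exponentials of nilpotents\<close>

definition munit :: "'r::finite \<Rightarrow> 'r \<Rightarrow> 'r cmat" where
  "munit i j = (\<chi> p q. if p = i \<and> q = j then 1 else 0)"

lemma munit_nth [simp]: "munit i j $ p $ q = (if p = i \<and> q = j then 1 else 0)"
  by (simp add: munit_def)

context
  fixes \<beta> :: "'r::finite cmat \<Rightarrow> 'n::finite cmat"
  assumes conn: "invariant_conn \<beta>"
begin

lemma conn_add: "\<beta> (A + B) = \<beta> A + \<beta> B"
  and conn_msc: "\<beta> (msc c A) = msc c (\<beta> A)"
  and conn_bracket: "\<beta> (A ** B - B ** A) = \<beta> A ** \<beta> B - \<beta> B ** \<beta> A"
  using conn by (auto simp: invariant_conn_def)

lemma conn_zero: "\<beta> 0 = 0"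
  using conn_msc[of 0 0] by simp

lemma conn_minus: "\<beta> (- A) = - \<beta> A"
  using conn_add[of A "- A"] by (simp add: conn_zero eq_neg_iff_add_eq_0 add.commute)

lemma conn_diff: "\<beta> (A - B) = \<beta> A - \<beta> B"
  using conn_add[of A "- B"] by (simp add: conn_minus)

lemma conn_sum: "\<beta> (\<Sum>k\<in>K. F k) = (\<Sum>k\<in>K. \<beta> (F k))"
  by (induction K rule: infinite_finite_induct) (auto simp: conn_zero conn_add)

lemma conn_entry: "\<exists>c. \<forall>A. \<beta> A $ k $ l = (\<Sum>i\<in>UNIV. \<Sum>j\<in>UNIV. A $ i $ j * c i j)"
proof -
  have "(\<Sum>i\<in>UNIV. \<Sum>j\<in>UNIV. A $ i $ j * (if p = i \<and> q = j then 1 else 0)) = A $ p $ q"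
    for A :: "'r cmat" and p q
  proof -
    have "(\<Sum>i\<in>UNIV. \<Sum>j\<in>UNIV. A $ i $ j * (if p = i \<and> q = j then 1 else 0)) =
        (\<Sum>i\<in>UNIV. if p = i then \<Sum>j\<in>UNIV. if q = j then A $ i $ j else 0 else 0)"
      by (intro sum.cong refl) (simp add: mult_delta_right)
    then show ?thesis by simp
  qed
  then have "A = (\<Sum>i\<in>UNIV. \<Sum>j\<in>UNIV. msc (A $ i $ j) (munit i j))" for A :: "'r cmat"
    by (simp add: vec_eq_iff sum_component)
  then have eq: "\<beta> A = \<beta> (\<Sum>i\<in>UNIV. \<Sum>j\<in>UNIV. msc (A $ i $ j) (munit i j))" for A
    by (rule arg_cong)
  have "\<beta> A $ k $ l = (\<Sum>i\<in>UNIV. \<Sum>j\<in>UNIV. A $ i $ j * \<beta> (munit i j) $ k $ l)" for A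
    by (subst eq) (simp only: conn_sum conn_msc sum_component msc_nth)
  then show ?thesis
    by (intro exI[of _ "\<lambda>i j. \<beta> (munit i j) $ k $ l"] allI)
qed

lemma mderiv_conn:
  assumes "mderiv F D t"
  shows "mderiv (\<lambda>s. \<beta> (F s)) (\<beta> D) t"
proof (rule mderivI)
  fix k l
  obtain c where c: "\<And>A. \<beta> A $ k $ l = (\<Sum>i\<in>UNIV. \<Sum>j\<in>UNIV. A $ i $ j * c i j)"
    using conn_entry by blast
  show "((\<lambda>s. \<beta> (F s) $ k $ l) has_field_derivative \<beta> D $ k $ l) (at t)"
    unfolding c by (intro DERIV_sum DERIV_cmult_right mderivD[OF assms])
qed

lemma function_ring_conn:
  assumes "function_ring R" "\<And>i j. (\<lambda>x. F x $ i $ j) \<in> R"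
  shows "(\<lambda>x. \<beta> (F x) $ k $ l) \<in> R"
proof -
  obtain c where c: "\<And>A. \<beta> A $ k $ l = (\<Sum>i\<in>UNIV. \<Sum>j\<in>UNIV. A $ i $ j * c i j)"
    using conn_entry by blast
  show ?thesis
    unfolding c using assms by (intro function_ring_sum function_ringD)
qed

end

lemma scaleR_eq_msc: "c *\<^sub>R A = msc (of_real c) A"
  by (simp add: vec_eq_iff complex_eq_iff)

section \<open>Powers and truncated exponentials of nilpotent matrices\<close>

primrec mpow :: "'n::finite cmat \<Rightarrow> nat \<Rightarrow> 'n cmat" where
  "mpow X 0 = mat 1"
| "mpow X (Suc m) = X ** mpow X m"

lemma mpow_commute: "X ** Y = Y ** X \<Longrightarrow> mpow X m ** Y = Y ** mpow X m"
proof (induction m)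
  case (Suc m)
  have "mpow X (Suc m) ** Y = X ** (mpow X m ** Y)" by (simp add: matrix_mul_assoc)
  also have "\<dots> = (X ** Y) ** mpow X m" using Suc by (simp add: matrix_mul_assoc)
  finally show ?case using Suc.prems by (simp add: matrix_mul_assoc)
qed simp

lemma mpow_zero_mono: "m \<le> k \<Longrightarrow> mpow X m = 0 \<Longrightarrow> mpow X k = 0"
  by (induction k rule: dec_induct) auto

text \<open>If \<open>[H, X] = X\<close> then \<open>X^m\<close> is an eigenvector of \<open>ad H\<close> for the eigenvalue \<open>m\<close>, which
  exceeds the operator norm of \<open>ad H\<close> for large \<open>m\<close>.\<close>

lemma nilpotent_of_eigenvector:
  fixes H :: "'n::finite cmat"
  shows "\<exists>N. \<forall>X. H ** X - X ** H = X \<longrightarrow> mpow X N = 0"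
proof -
  have "linear (\<lambda>Y. H ** Y - Y ** H)"
    by (intro linearI) (simp_all add: mat_algebra scaleR_eq_msc)
  from linear_bounded[OF this] obtain B where B: "\<And>Y. norm (H ** Y - Y ** H) \<le> B * norm Y"
    by auto
  \<comment> \<open>The bound on ad H does not involve \<open>X\<close>, so one exponent serves all
    eigenvectors; a fixed truncation of the exponential depends on this uniformity.\<close>
  obtain N :: nat where N: "B < real N"
    using reals_Archimedean2 by blast
  have "mpow X N = 0" if X: "H ** X - X ** H = X" for X
  proof -
    have *: "H ** mpow X m - mpow X m ** H = msc (of_nat m) (mpow X m)" for m
    proof (induction m)
      case (Suc m)
      have "H ** mpow X (Suc m) - mpow X (Suc m) ** H =
          (H ** X - X ** H) ** mpow X m + X ** (H ** mpow X m - mpow X m ** H)"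
        by (simp add: mat_algebra)
      also have "\<dots> = msc (of_nat (Suc m)) (mpow X (Suc m))"
        unfolding Suc X by (simp add: msc_mult_right msc_add_left)
      finally show ?case .
    qed simp
    have "msc (of_nat N) (mpow X N) = real N *\<^sub>R mpow X N"
      by (simp add: scaleR_eq_msc)
    then have "real N * norm (mpow X N) \<le> B * norm (mpow X N)"
      using B[of "mpow X N"] * by simp
    then show ?thesis
      using N by (simp add: mult_le_cancel_right)
  qed
  then show ?thesis by blast
qed

text \<open>The exponential series cut off after degree \<open>N\<close>: a polynomial in the
  entries, and the exact exponential when the \<open>N\<close>-th power of \<open>X\<close>
  vanishes.\<close>

definition expn :: "nat \<Rightarrow> 'n::finite cmat \<Rightarrow> 'n cmat" where
  "expn N X = (\<Sum>m\<le>N. msc (1 / fact m) (mpow X m))"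

lemma expn_0 [simp]: "expn N (0 :: 'n::finite cmat) = mat 1"
proof -
  have "msc (1 / fact m) (mpow (0 :: 'n cmat) m) = (if m = 0 then mat 1 else 0)" for m :: nat
    by (cases m) auto
  then show ?thesis unfolding expn_def by (simp only: sum.delta finite_atMost) simp
qed

lemma expn_Suc: "expn (Suc N) X = expn N X + msc (1 / fact (Suc N)) (mpow X (Suc N))"
  by (simp add: expn_def)

lemma expn_commute: "X ** Y = Y ** X \<Longrightarrow> expn N X ** Y = Y ** expn N X"
  by (induction N) (simp_all add: expn_Suc mat_algebra mpow_commute del: mpow.simps(2),
      simp add: expn_def)

lemma mderiv_mpow:
  assumes F: "mderiv F D t" and comm: "F t ** D = D ** F t"
  shows "mderiv (\<lambda>s. mpow (F s) (Suc m)) (msc (of_nat (Suc m)) (mpow (F t) m ** D)) t"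
proof (induction m)
  case 0
  then show ?case using F by simp
next
  case (Suc m)
  have "D ** mpow (F t) (Suc m) + F t ** msc (of_nat (Suc m)) (mpow (F t) m ** D) =
      msc (of_nat (Suc (Suc m))) (mpow (F t) (Suc m) ** D)"
    unfolding mpow_commute[OF comm, symmetric]
    by (simp only: of_nat_Suc[of "Suc m"] msc_add_left msc_one msc_mult_right matrix_mul_assoc
        mpow.simps)
  with mderiv_mult[OF F Suc] show ?case by simp
qed

text \<open>Differentiation lowers the truncation by one degree; the missing top term X^N / N! is
  zero by nilpotency at \<open>t\<close>.\<close>

lemma mderiv_expn:
  assumes F: "mderiv F D t" and comm: "F t ** D = D ** F t" and nil: "mpow (F t) N = 0"
  shows "mderiv (\<lambda>s. expn N (F s)) (expn N (F t) ** D) t"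
proof -
  have "mderiv (\<lambda>s. expn N (F s)) ((expn N (F t) - msc (1 / fact N) (mpow (F t) N)) ** D) t"
  proof (induction N)
    case 0
    then show ?case by (simp add: expn_def mderiv_const)
  next
    case (Suc N)
    have "mderiv (\<lambda>s. msc (1 / fact (Suc N)) (mpow (F s) (Suc N)))
        (msc 0 (mpow (F t) (Suc N)) + msc (1 / fact (Suc N)) (msc (of_nat (Suc N)) (mpow (F t) N ** D))) t"
      by (intro mderiv_msc mderiv_mpow F comm DERIV_const)
    moreover have "1 / fact (Suc N) * of_nat (Suc N) = (1 / fact N :: complex)"
      by (simp add: field_simps del: of_nat_Suc)
    ultimately have "mderiv (\<lambda>s. msc (1 / fact (Suc N)) (mpow (F s) (Suc N)))
        (msc (1 / fact N) (mpow (F t) N ** D)) t"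
      by (simp only: msc_msc msc_zero add_0_left)
    from mderiv_add[OF Suc this] show ?case
      by (simp add: expn_Suc mat_algebra del: mpow.simps(2))
  qed
  then show ?thesis using nil by simp
qed

lemma function_ring_expn:
  assumes R: "function_ring R" and F: "\<And>i j. (\<lambda>x. F x $ i $ j) \<in> R"
  shows "(\<lambda>x. expn N (F x) $ i $ j) \<in> R"
proof -
  have "(\<lambda>x. mpow (F x) m $ i $ j) \<in> R" for m i j
    by (induction m arbitrary: i j)
       (simp_all add: mat_def function_ringD(1)[OF R] function_ring_matrix_mult[OF R] F)
  then show ?thesis
    unfolding expn_def sum_component msc_nth by (intro function_ring_intros R) auto
qed

text \<open>The abelian nilradical of the block triangular matrices given by \<open>I\<close> and
  its complement. For suitable \<open>I\<close> it contains each elementary factor used later: a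
  column, a row, or a single matrix unit.\<close>

definition nilp :: "'r::finite set \<Rightarrow> 'r cmat set" where
  "nilp I = {u. \<forall>i j. u $ i $ j \<noteq> 0 \<longrightarrow> i \<in> I \<and> j \<notin> I}"

lemma nilp_mult: "u \<in> nilp I \<Longrightarrow> v \<in> nilp I \<Longrightarrow> u ** v = 0"
  unfolding nilp_def vec_eq_iff matrix_matrix_mult_def
  by (simp, intro allI sum.neutral) fastforce

lemma nilp_msc: "u \<in> nilp I \<Longrightarrow> msc c u \<in> nilp I"
  by (auto simp: nilp_def)

lemma nilp_minus: "u \<in> nilp I \<Longrightarrow> - u \<in> nilp I"
  by (auto simp: nilp_def)

lemma nilp_one_minus:
  assumes "u \<in> nilp I"
  shows "(mat 1 + u) ** (mat 1 - u) = mat 1" "(mat 1 - u) ** (mat 1 + u) = mat 1"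
  using nilp_mult[OF assms assms] by (simp_all add: mat_algebra)

lemma invertible_one_plus_nilp: "u \<in> nilp I \<Longrightarrow> invertible (mat 1 + u)"
  using nilp_one_minus unfolding invertible_def by blast

text \<open>Conjugation by \<open>diag(2, 1)\<close> doubles \<open>u\<close>, so \<open>1 + u\<close> and its square \<open>1 + 2u\<close> have the same
  determinant.\<close>

lemma det_one_plus_nilp:
  assumes u: "u \<in> nilp I"
  shows "det (mat 1 + u) = 1"
proof -
  define D :: "'a cmat" where "D = (\<chi> i j. if i = j then (if i \<in> I then 2 else 1) else 0)"
  have "D ** (mat 1 + u) = (mat 1 + msc 2 u) ** D"
  proof -
    have "D ** u = msc 2 u"
    proof -
      have "(D ** u) $ i $ j = (if i \<in> I then 2 else 1) * u $ i $ j" for i j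
        unfolding D_def matrix_matrix_mult_def
        by (simp add: if_distrib[of "\<lambda>x. x * _"] cong: if_cong)
      then show ?thesis using u by (auto simp: vec_eq_iff nilp_def)
    qed
    moreover have "u ** D = u"
    proof -
      have "(u ** D) $ i $ j = u $ i $ j * (if j \<in> I then 2 else 1)" for i j
        unfolding D_def matrix_matrix_mult_def
        by (simp add: if_distrib[of "\<lambda>x. _ * x"] cong: if_cong)
      then show ?thesis using u by (auto simp: vec_eq_iff nilp_def)
    qed
    ultimately show ?thesis by (simp add: mat_algebra)
  qed
  then have "det D * det (mat 1 + u) = det (mat 1 + msc 2 u) * det D"
    by (metis det_mul)
  moreover have "det D \<noteq> 0"
    by (subst det_diagonal) (auto simp: D_def)
  moreover have "(mat 1 + u) ** (mat 1 + u) = mat 1 + msc 2 u"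
    using nilp_mult[OF u u] by (simp add: mat_algebra) (simp add: vec_eq_iff)
  then have "det (mat 1 + msc 2 u) = det (mat 1 + u) * det (mat 1 + u)"
    by (metis det_mul)
  moreover have "det (mat 1 + u) \<noteq> 0"
    using invertible_one_plus_nilp[OF u] by (simp add: invertible_det_nz)
  ultimately show ?thesis by simp
qed

definition nil_bound :: "('r::finite cmat \<Rightarrow> 'n::finite cmat) \<Rightarrow> nat \<Rightarrow> bool" where
  "nil_bound \<beta> N \<longleftrightarrow> (\<forall>I. \<forall>u\<in>nilp I. mpow (\<beta> u) N = 0)"

text \<open>The indicator diagonal \<open>H\<close> of \<open>I\<close> satisfies [H, u] = u on
  \<open>nilp I\<close>, so \<beta> u is an eigenvector of ad (\<beta> H) for the eigenvalue 1.
  There are finitely many \<open>I\<close>, hence a common exponent.\<close>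

lemma ex_nil_bound:
  assumes conn: "invariant_conn (\<beta> :: 'r::finite cmat \<Rightarrow> 'n::finite cmat)"
  shows "\<exists>N. nil_bound \<beta> N"
proof -
  have "\<exists>N. \<forall>u\<in>nilp I. mpow (\<beta> u) N = 0" for I
  proof -
    define H :: "'r cmat" where "H = (\<chi> i j. if i = j then (if i \<in> I then 1 else 0) else 0)"
    have "H ** u - u ** H = u" if u: "u \<in> nilp I" for u
    proof -
      have "(H ** u) $ i $ j = (if i \<in> I then 1 else 0) * u $ i $ j" for i j
        unfolding H_def matrix_matrix_mult_def
        by (simp add: if_distrib[of "\<lambda>x. x * _"] cong: if_cong)
      moreover have "(u ** H) $ i $ j = u $ i $ j * (if j \<in> I then 1 else 0)" for i j
        unfolding H_def matrix_matrix_mult_def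
        by (simp add: if_distrib[of "\<lambda>x. _ * x"] cong: if_cong)
      ultimately show ?thesis using u by (auto simp: vec_eq_iff nilp_def)
    qed
    then have "\<beta> H ** \<beta> u - \<beta> u ** \<beta> H = \<beta> u" if "u \<in> nilp I" for u
      using that conn_bracket[OF conn, of H u] by simp
    then show ?thesis
      using nilpotent_of_eigenvector[of "\<beta> H"] by blast
  qed
  then obtain f where f: "\<And>I u. u \<in> nilp I \<Longrightarrow> mpow (\<beta> u) (f I) = 0" by metis
  have "f I \<le> Max (range f)" for I by (intro Max_ge) auto
  then have "nil_bound \<beta> (Max (range f))"
    unfolding nil_bound_def using f mpow_zero_mono by blast
  then show ?thesis ..
qed

subsection \<open>Lifting curves along a representation\<close>

text \<open>A pair \<open>(g, y)\<close> is admissible if \<open>y\<close> could be the value at \<open>g\<close> of a group representation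
  with derivative \<open>\<beta>\<close>: \<open>Ad y \<circ> \<beta> = \<beta> \<circ> Ad g\<close>.\<close>

definition adm :: "('r::finite cmat \<Rightarrow> 'n::finite cmat) \<Rightarrow> 'r cmat \<Rightarrow> 'n cmat \<Rightarrow> bool" where
  "adm \<beta> g y \<longleftrightarrow> invertible g \<and> invertible y \<and> (\<forall>X Y. g ** X = Y ** g \<longrightarrow> y ** \<beta> X = \<beta> Y ** y)"

text \<open>\<open>B\<close> is the logarithmic derivative \<gamma>^-1 \<gamma>', and the equation
  says y^-1 y' = \<beta>(\<gamma>^-1 \<gamma>'). Admissibility is carried along because the product
  rule for lifts uses it.\<close>

definition lifts ::
  "('r::finite cmat \<Rightarrow> 'n::finite cmat) \<Rightarrow> (complex \<Rightarrow> 'r cmat) \<Rightarrow> (complex \<Rightarrow> 'n cmat) \<Rightarrow> complex \<Rightarrow> bool"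
  where "lifts \<beta> \<gamma> y t \<longleftrightarrow> adm \<beta> (\<gamma> t) (y t) \<and>
    (\<exists>B. mderiv \<gamma> (\<gamma> t ** B) t \<and> mderiv y (y t ** \<beta> B) t)"

lemma adm_one: "adm \<beta> (mat 1) (mat 1)"
  by (auto simp: adm_def invertible_def)

lemma adm_mult:
  assumes "adm \<beta> g y" "adm \<beta> h z"
  shows "adm \<beta> (g ** h) (y ** z)"
  unfolding adm_def
proof (intro conjI allI impI)
  show "invertible (g ** h)" "invertible (y ** z)"
    using assms by (auto simp: adm_def invertible_mult)
next
  fix X Y assume eq: "g ** h ** X = Y ** (g ** h)"
  define W where "W = h ** X ** matrix_inv h"
  have h: "h ** matrix_inv h = mat 1" "matrix_inv h ** h = mat 1"
    using assms(2) by (auto simp: adm_def invertible_mult_matrix_inv)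
  have 1: "h ** X = W ** h"
    by (simp add: W_def matrix_mul_assoc[symmetric] h)
  have "g ** W = (g ** h ** X) ** matrix_inv h"
    by (simp add: W_def matrix_mul_assoc)
  also have "\<dots> = Y ** g ** (h ** matrix_inv h)"
    by (simp add: eq matrix_mul_assoc)
  also have "\<dots> = Y ** g" by (simp add: h)
  finally have 2: "g ** W = Y ** g" .
  have "y ** z ** \<beta> X = y ** (z ** \<beta> X)" by (simp add: matrix_mul_assoc)
  also have "\<dots> = y ** \<beta> W ** z" using assms(2) 1 by (simp add: adm_def matrix_mul_assoc)
  also have "\<dots> = \<beta> Y ** y ** z" using assms(1) 2 by (simp add: adm_def)
  finally show "y ** z ** \<beta> X = \<beta> Y ** (y ** z)" by (simp add: matrix_mul_assoc)
qed

lemma adm_inverse: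
  assumes "adm \<beta> g y"
  shows "adm \<beta> (matrix_inv g) (matrix_inv y)"
  unfolding adm_def
proof (intro conjI allI impI)
  have g: "g ** matrix_inv g = mat 1" "matrix_inv g ** g = mat 1"
    and y: "y ** matrix_inv y = mat 1" "matrix_inv y ** y = mat 1"
    using assms by (auto simp: adm_def invertible_mult_matrix_inv)
  then show "invertible (matrix_inv g)" "invertible (matrix_inv y)"
    unfolding invertible_def by blast+
  fix X Y assume eq: "matrix_inv g ** X = Y ** matrix_inv g"
  have "g ** Y = g ** (Y ** matrix_inv g) ** g"
    by (simp add: matrix_mul_assoc[symmetric] g)
  also have "\<dots> = g ** (matrix_inv g ** X) ** g" by (simp only: eq)
  also have "\<dots> = X ** g" by (simp add: matrix_mul_assoc g)
  finally have "y ** \<beta> Y = \<beta> X ** y" using assms by (simp add: adm_def)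
  then have "matrix_inv y ** (y ** \<beta> Y) ** matrix_inv y = matrix_inv y ** (\<beta> X ** y) ** matrix_inv y"
    by simp
  then have "(matrix_inv y ** y) ** \<beta> Y ** matrix_inv y = matrix_inv y ** \<beta> X ** (y ** matrix_inv y)"
    by (simp only: matrix_mul_assoc)
  then show "matrix_inv y ** \<beta> X = \<beta> Y ** matrix_inv y" by (simp add: y)
qed

lemma lifts_const:
  assumes "adm \<beta> g y" "invariant_conn \<beta>"
  shows "lifts \<beta> (\<lambda>s. g) (\<lambda>s. y) t"
  unfolding lifts_def using assms(1)
  by (auto intro!: exI[of _ 0] simp: conn_zero[OF assms(2)] mderiv_const)

text \<open>The logarithmic derivative of \<gamma> \<delta> is \<delta>^-1 B \<delta> + C.
  Admissibility of the second pair turns \<beta>(\<delta>^-1 B \<delta>) into z^-1 \<beta>(B) z,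
  which is the term in the logarithmic derivative of y z.\<close>

lemma lifts_mult:
  assumes conn: "invariant_conn \<beta>" and 1: "lifts \<beta> \<gamma> y t" and 2: "lifts \<beta> \<delta> z t"
  shows "lifts \<beta> (\<lambda>s. \<gamma> s ** \<delta> s) (\<lambda>s. y s ** z s) t"
proof -
  obtain B where B: "mderiv \<gamma> (\<gamma> t ** B) t" "mderiv y (y t ** \<beta> B) t"
    using 1 by (auto simp: lifts_def)
  obtain C where C: "mderiv \<delta> (\<delta> t ** C) t" "mderiv z (z t ** \<beta> C) t"
    using 2 by (auto simp: lifts_def)
  have a: "adm \<beta> (\<gamma> t) (y t)" "adm \<beta> (\<delta> t) (z t)" using 1 2 by (auto simp: lifts_def)
  define B' where "B' = matrix_inv (\<delta> t) ** B ** \<delta> t"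
  have "\<delta> t ** B' = (\<delta> t ** matrix_inv (\<delta> t)) ** B ** \<delta> t"
    by (simp add: B'_def matrix_mul_assoc)
  then have B': "\<delta> t ** B' = B ** \<delta> t"
    using a(2) by (simp add: adm_def invertible_mult_matrix_inv)
  then have "z t ** \<beta> B' = \<beta> B ** z t" using a(2) by (simp add: adm_def)
  with B' have "\<gamma> t ** B ** \<delta> t + \<gamma> t ** (\<delta> t ** C) = \<gamma> t ** \<delta> t ** (B' + C)"
    "y t ** \<beta> B ** z t + y t ** (z t ** \<beta> C) = y t ** z t ** \<beta> (B' + C)"
    by (simp_all add: matrix_add_ldistrib conn_add[OF conn] matrix_mul_assoc[symmetric])
  with mderiv_mult[OF B(1) C(1)] mderiv_mult[OF B(2) C(2)]
  show ?thesis unfolding lifts_def using adm_mult[OF a] by auto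
qed

lemma lifts_unique_B:
  assumes "lifts \<beta> \<gamma> y t" "mderiv \<gamma> (\<gamma> t ** B) t"
  shows "mderiv y (y t ** \<beta> B) t"
proof -
  obtain C where C: "mderiv \<gamma> (\<gamma> t ** C) t" "mderiv y (y t ** \<beta> C) t"
    using assms by (auto simp: lifts_def)
  have inv: "matrix_inv (\<gamma> t) ** \<gamma> t = mat 1"
    using assms by (simp add: lifts_def adm_def invertible_mult_matrix_inv)
  have "\<gamma> t ** B = \<gamma> t ** C" by (rule mderiv_unique[OF assms(2) C(1)])
  then have "(matrix_inv (\<gamma> t) ** \<gamma> t) ** B = (matrix_inv (\<gamma> t) ** \<gamma> t) ** C"
    by (simp add: matrix_mul_assoc[symmetric])
  then show ?thesis using C(2) inv by simp
qed

section \<open>Elementary matrices and their exponentials\<close>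

context
  fixes \<beta> :: "'r::finite cmat \<Rightarrow> 'n::finite cmat" and N :: nat
  assumes conn: "invariant_conn \<beta>" and N: "nil_bound \<beta> N"
begin

text \<open>Entries that vanish along the whole curve have derivative zero, so \<open>u'\<close>
  stays in \<open>nilp I\<close>. Products there vanish, hence \<beta> (u t) and \<beta> u' commute,
  as the derivative of the exponential demands.\<close>

lemma mderiv_expn_conn:
  assumes u: "\<And>s. u s \<in> nilp I" and d: "mderiv u u' t"
  shows "mderiv (\<lambda>s. expn N (\<beta> (u s))) (expn N (\<beta> (u t)) ** \<beta> u') t" "u' \<in> nilp I"
proof -
  show u': "u' \<in> nilp I"
    unfolding nilp_def
  proof (intro CollectI allI impI)
    fix i j assume ne: "u' $ i $ j \<noteq> 0"
    show "i \<in> I \<and> j \<notin> I"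
    proof (rule ccontr)
      assume "\<not> (i \<in> I \<and> j \<notin> I)"
      then have "u s $ i $ j = 0" for s using u[of s] by (auto simp: nilp_def)
      then have "((\<lambda>s. u s $ i $ j) has_field_derivative 0) (at t)" by simp
      then show False using ne mderivD[OF d, of i j] DERIV_unique by blast
    qed
  qed
  have "u t ** u' - u' ** u t = 0" using nilp_mult[OF u u'] nilp_mult[OF u' u] by simp
  then have "\<beta> (u t) ** \<beta> u' = \<beta> u' ** \<beta> (u t)"
    using conn_bracket[OF conn, of "u t" u'] by (simp add: conn_zero[OF conn])
  then show "mderiv (\<lambda>s. expn N (\<beta> (u s))) (expn N (\<beta> (u t)) ** \<beta> u') t"
    using N u by (intro mderiv_expn mderiv_conn[OF conn] d) (auto simp: nil_bound_def)
qed

lemma mderiv_expn_line: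
  assumes u: "u \<in> nilp I"
  shows "mderiv (\<lambda>s. expn N (\<beta> (msc s u))) (expn N (\<beta> (msc t u)) ** \<beta> u) t"
proof (rule mderiv_expn_conn(1))
  show "msc s u \<in> nilp I" for s using u by (rule nilp_msc)
  show "mderiv (\<lambda>s. msc s u) u t"
    using mderiv_msc[OF DERIV_ident mderiv_const, of u t] by simp
qed

lemma expn_conn_commute: "expn N (\<beta> (msc t u)) ** \<beta> u = \<beta> u ** expn N (\<beta> (msc t u))"
  by (rule expn_commute) (simp add: conn_msc[OF conn] mat_algebra)

lemma expn_conn_inverse:
  assumes u: "u \<in> nilp I"
  shows "expn N (\<beta> u) ** expn N (\<beta> (- u)) = mat 1"
proof -
  define F where "F t = expn N (\<beta> (msc t u)) ** expn N (\<beta> (msc t (- u)))" for t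
  have "mderiv F 0 t" for t
  proof -
    have "\<beta> (- u) = - \<beta> u" by (rule conn_minus[OF conn])
    then have "expn N (\<beta> (msc t u)) ** \<beta> u ** expn N (\<beta> (msc t (- u))) +
       expn N (\<beta> (msc t u)) ** (expn N (\<beta> (msc t (- u))) ** \<beta> (- u)) = 0"
      unfolding expn_conn_commute[of t "- u"] by (simp add: mat_algebra)
    then show ?thesis
      using mderiv_mult[OF mderiv_expn_line[OF u, of t] mderiv_expn_line[OF nilp_minus[OF u], of t]]
      by (simp add: F_def[abs_def])
  qed
  then have "F 0 = F 1" by (intro mderiv_zero_imp_eq[of "{}"]) auto
  then show ?thesis by (simp add: F_def conn_zero[OF conn])
qed

text \<open>Conjugation by an exponential integrates the bracket: e(t u) \<beta>(W t) e(-t u), with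
  W t = (1 + t u)^-1 Y (1 + t u), has derivative zero in t. It equals \<beta> Y at t = 0, and at t =
  1 it is the conjugate of \<beta> X.\<close>

lemma adm_elementary:
  assumes u: "u \<in> nilp I"
  shows "adm \<beta> (mat 1 + u) (expn N (\<beta> u))"
  unfolding adm_def
proof (intro conjI allI impI)
  show "invertible (mat 1 + u)" by (rule invertible_one_plus_nilp[OF u])
  have inv: "expn N (\<beta> u) ** expn N (\<beta> (- u)) = mat 1" "expn N (\<beta> (- u)) ** expn N (\<beta> u) = mat 1"
    using expn_conn_inverse[OF u] expn_conn_inverse[OF nilp_minus[OF u]] by auto
  then show "invertible (expn N (\<beta> u))" unfolding invertible_def by blast
  fix X Y assume eq: "(mat 1 + u) ** X = Y ** (mat 1 + u)"
  define W where "W t = (mat 1 - msc t u) ** Y ** (mat 1 + msc t u)" for t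
  define E where "E t = expn N (\<beta> (msc t u))" for t
  define E' where "E' t = expn N (\<beta> (msc t (- u)))" for t
  define F where "F t = E t ** \<beta> (W t) ** E' t" for t
  have uu: "u ** u = 0" by (rule nilp_mult[OF u u])
  have "mderiv F 0 t" for t
  proof -
    have dl: "mderiv (\<lambda>s. msc s u) u t"
      using mderiv_msc[OF DERIV_ident mderiv_const, of u t] by simp
    have "mderiv W (((0 - u) ** Y + (mat 1 - msc t u) ** 0) ** (mat 1 + msc t u)
        + (mat 1 - msc t u) ** Y ** (0 + u)) t"
      unfolding W_def by (intro mderiv_mult mderiv_add mderiv_diff mderiv_const dl)
    moreover have "((0 - u) ** Y + (mat 1 - msc t u) ** 0) ** (mat 1 + msc t u)
        + (mat 1 - msc t u) ** Y ** (0 + u) = W t ** u - u ** W t"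
      using uu by (simp add: W_def mat_algebra matrix_mul_assoc[symmetric, of _ u u]
          arg_cong[OF uu, of "\<lambda>x. x ** _"])
    ultimately have dW: "mderiv (\<lambda>s. \<beta> (W s)) (\<beta> (W t) ** \<beta> u - \<beta> u ** \<beta> (W t)) t"
      using mderiv_conn[OF conn] conn_bracket[OF conn] by metis
    have "mderiv F ((E t ** \<beta> u ** \<beta> (W t) + E t ** (\<beta> (W t) ** \<beta> u - \<beta> u ** \<beta> (W t))) ** E' t
        + E t ** \<beta> (W t) ** (E' t ** \<beta> (- u))) t"
      unfolding F_def E_def E'_def
      by (intro mderiv_mult dW mderiv_expn_line[OF u] mderiv_expn_line[OF nilp_minus[OF u]])
    moreover have "E' t ** \<beta> (- u) = - (\<beta> u ** E' t)"
      unfolding E'_def expn_conn_commute by (simp add: conn_minus[OF conn] matrix_minus_left)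
    ultimately show ?thesis by (simp add: mat_algebra)
  qed
  then have "F 0 = F 1" by (intro mderiv_zero_imp_eq[of "{}"]) auto
  moreover have "W 1 = X"
  proof -
    have "W 1 = (mat 1 - u) ** ((mat 1 + u) ** X)"
      unfolding eq by (simp add: W_def matrix_mul_assoc)
    then show ?thesis using nilp_one_minus(2)[OF u] by (simp add: matrix_mul_assoc)
  qed
  ultimately have "\<beta> Y = expn N (\<beta> u) ** \<beta> X ** expn N (\<beta> (- u))"
    by (simp add: F_def E_def E'_def W_def conn_zero[OF conn])
  then show "expn N (\<beta> u) ** \<beta> X = \<beta> Y ** expn N (\<beta> u)"
    by (simp add: matrix_mul_assoc[symmetric] inv)
qed

text \<open>Since u u' = 0, the product (1 + u) u' is u', so the logarithmic derivative of 1 + u is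
  u' itself.\<close>

lemma lifts_elementary:
  assumes u: "\<And>s. u s \<in> nilp I" and d: "mderiv u u' t"
  shows "lifts \<beta> (\<lambda>s. mat 1 + u s) (\<lambda>s. expn N (\<beta> (u s))) t"
  unfolding lifts_def
proof (intro conjI exI)
  show "adm \<beta> (mat 1 + u t) (expn N (\<beta> (u t)))" by (rule adm_elementary[OF u])
  show "mderiv (\<lambda>s. expn N (\<beta> (u s))) (expn N (\<beta> (u t)) ** \<beta> u') t"
    by (rule mderiv_expn_conn(1)[OF u d])
  have "(mat 1 + u t) ** u' = 0 + u'"
    using nilp_mult[OF u mderiv_expn_conn(2)[OF u d]] by (simp add: mat_algebra)
  then show "mderiv (\<lambda>s. mat 1 + u s) ((mat 1 + u t) ** u') t"
    using mderiv_add[OF mderiv_const[of "mat 1" t] d] by simp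
qed

end

subsection \<open>Gaussian elimination in the special linear group\<close>

text \<open>A copy of the special linear group of size |S| inside one fixed matrix type, so that the
  induction on the size changes a set and not a type.\<close>

definition SLs :: "'r set \<Rightarrow> ('r::finite) cmat set" where
  "SLs S = {g. det g = 1 \<and> (\<forall>i j. i \<notin> S \<or> j \<notin> S \<longrightarrow> g $ i $ j = (if i = j then 1 else 0))}"

text \<open>The equation \<rho>^-1 d\<rho> = \<beta>(g^-1 dg), tested along curves that stay in
  \<open>X\<close> near \<open>t\<close>. Constant curves already yield admissibility of the single
  values of \<rho> on \<open>X\<close>.\<close>

definition integrates_on ::
  "('r::finite cmat \<Rightarrow> 'n::finite cmat) \<Rightarrow> 'r cmat set \<Rightarrow> ('r cmat \<Rightarrow> 'n cmat) \<Rightarrow> bool" where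
  "integrates_on \<beta> X \<rho> \<longleftrightarrow> (\<forall>\<gamma> D t. (\<forall>\<^sub>F s in nhds t. \<gamma> s \<in> X) \<longrightarrow> mderiv \<gamma> D t \<longrightarrow>
     lifts \<beta> \<gamma> (\<lambda>s. \<rho> (\<gamma> s)) t)"

lemma integrates_onD:
  "integrates_on \<beta> X \<rho> \<Longrightarrow> \<forall>\<^sub>F s in nhds t. \<gamma> s \<in> X \<Longrightarrow> \<exists>D. mderiv \<gamma> D t \<Longrightarrow>
    lifts \<beta> \<gamma> (\<lambda>s. \<rho> (\<gamma> s)) t"
  unfolding integrates_on_def by auto

lemma lifts_cong:
  assumes l: "lifts \<beta> \<gamma> y t" and "\<forall>\<^sub>F s in nhds t. \<gamma> s = \<delta> s" "\<forall>\<^sub>F s in nhds t. y s = z s"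
  shows "lifts \<beta> \<delta> z t"
proof -
  have "\<gamma> t = \<delta> t" "y t = z t"
    using assms(2,3) by (auto dest: eventually_nhds_x_imp_x)
  moreover obtain B where "mderiv \<gamma> (\<gamma> t ** B) t" "mderiv y (y t ** \<beta> B) t"
    using l by (auto simp: lifts_def)
  then have "mderiv \<delta> (\<gamma> t ** B) t" "mderiv z (y t ** \<beta> B) t"
    using assms(2,3) by (auto intro: mderiv_cong_ev)
  ultimately show ?thesis using l unfolding lifts_def by auto
qed

lemma mderiv_ex:
  assumes "\<And>i j. (\<lambda>s. F s $ i $ j) field_differentiable at t"
  shows "\<exists>D. mderiv F D t"
proof
  show "mderiv F (\<chi> i j. deriv (\<lambda>s. F s $ i $ j) t) t"
    by (rule mderivI) (simp add: DERIV_deriv_iff_field_differentiable assms)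
qed

lemma munit_mult: "munit i j ** munit p q = (if j = p then munit i q else 0)"
  by (auto simp: vec_eq_iff matrix_matrix_mult_def mult_delta_right intro!: sum.neutral)

section \<open>Elimination at the diagonal entry \<open>a\<close>, with \<open>k\<close> as
  auxiliary index\<close>

context
  fixes a k :: "'r::finite"
  assumes ak: "a \<noteq> k"
begin

definition torus :: "complex \<Rightarrow> 'r cmat" where
  "torus x = (\<chi> i j. if i = j then (if i = a then x else if i = k then inverse x else 1) else 0)"

definition elim_l :: "'r cmat \<Rightarrow> 'r cmat" where
  "elim_l g = (\<chi> i j. if j = a \<and> i \<noteq> a then g $ i $ a * inverse (g $ a $ a) else 0)"

definition elim_u :: "'r cmat \<Rightarrow> 'r cmat" where
  "elim_u g = (\<chi> i j. if i = a \<and> j \<noteq> a then inverse (g $ a $ a) * g $ a $ j else 0)"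

text \<open>The Schur complement of the pivot, bordered by 1. Its row \<open>k\<close> is multiplied
  by the pivot to offset the inverse in \<open>torus\<close>, which keeps the determinant equal to
  that of \<open>g\<close>.\<close>

definition elim_d :: "'r cmat \<Rightarrow> 'r cmat" where
  "elim_d g = (\<chi> i j. if i = a \<and> j = a then 1 else if i = a \<or> j = a then 0 else
     (if i = k then g $ a $ a else 1) * (g $ i $ j - g $ i $ a * (inverse (g $ a $ a) * g $ a $ j)))"

text \<open>Steinberg's relation h(x) = w(x) w(-1), where each triple product w(x) collapses to E +
  x P - x^-1 Q. Thus the torus needs no integration of its own: its lift comes from nilpotent
  exponentials.\<close>

lemma torus_eq:
  assumes x: "x \<noteq> 0"
  defines "P \<equiv> munit a k" and "Q \<equiv> munit k a"
  shows "torus x = (mat 1 + msc x P) ** (mat 1 + msc (- inverse x) Q) ** (mat 1 + msc x P) **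
     ((mat 1 + msc (- 1) P) ** (mat 1 + msc 1 Q) ** (mat 1 + msc (- 1) P))"
proof -
  define E where "E = mat 1 - munit a a - munit k k"
  have w: "(mat 1 + msc x P) ** (mat 1 + msc (- inverse x) Q) ** (mat 1 + msc x P) =
      E + (msc x P - msc (inverse x) Q)" if "x \<noteq> 0" for x
    using that ak unfolding P_def Q_def E_def
    by (simp add: mat_algebra munit_mult) (auto simp: vec_eq_iff mat_def)
  have e: "E ** E = E" "E ** P = 0" "E ** Q = 0" "P ** E = 0" "Q ** E = 0"
    using ak unfolding P_def Q_def E_def by (simp_all add: mat_algebra munit_mult)
  have "(E + (msc x P - msc (inverse x) Q)) ** (E + (msc (- 1) P - msc (inverse (- 1)) Q)) =
      E + (msc x (munit a a) + msc (inverse x) (munit k k))"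
    using ak by (simp add: mat_algebra e) (simp add: P_def Q_def munit_mult, simp add: vec_eq_iff)
  also have "\<dots> = torus x"
    using ak by (auto simp: vec_eq_iff E_def torus_def mat_def)
  finally show ?thesis
    using w[OF x] w[of "- 1"] by simp
qed

lemma elim_factorization:
  assumes x: "g $ a $ a \<noteq> 0"
  shows "g = (mat 1 + elim_l g) ** torus (g $ a $ a) ** elim_d g ** (mat 1 + elim_u g)"
proof -
  define x where "x = g $ a $ a"
  have T: "(torus x ** m) $ i $ j = (if i = a then x else if i = k then inverse x else 1) * m $ i $ j"
    for m :: "'r cmat" and i j
    unfolding torus_def matrix_matrix_mult_def by (simp add: mult_delta_left)
  have L: "(elim_l g ** m) $ i $ j = (if i \<noteq> a then g $ i $ a * inverse x * m $ a $ j else 0)"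
    for m :: "'r cmat" and i j
    unfolding elim_l_def matrix_matrix_mult_def x_def by (simp add: mult_delta_left)
  have U: "(m ** elim_u g) $ i $ j = (if j \<noteq> a then m $ i $ a * (inverse x * g $ a $ j) else 0)"
    for m :: "'r cmat" and i j
    unfolding elim_u_def matrix_matrix_mult_def x_def by (simp add: mult_delta_right)
  define m where "m = torus x ** elim_d g"
  have m: "m $ i $ j = (if i = a then (if j = a then x else 0) else if j = a then 0
     else g $ i $ j - g $ i $ a * (inverse x * g $ a $ j))" for i j
    unfolding m_def T using assms by (auto simp: elim_d_def x_def)
  define n where "n = (mat 1 + elim_l g) ** m"
  have n: "n $ i $ j = (if j = a then g $ i $ a else if i = a then 0
      else g $ i $ j - g $ i $ a * (inverse x * g $ a $ j))" for i j
    using assms by (auto simp: n_def mat_algebra L m x_def)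
  have "n ** (mat 1 + elim_u g) = g"
    using assms by (auto simp: vec_eq_iff mat_algebra U n x_def)
  then show ?thesis
    by (simp add: n_def m_def x_def matrix_mul_assoc)
qed

lemma elim_nilp: "elim_l g \<in> nilp (- {a})" "elim_u g \<in> nilp {a}"
  by (auto simp: nilp_def elim_l_def elim_u_def)

lemma munit_nilp: "msc x (munit a k) \<in> nilp {a}" "msc x (munit k a) \<in> nilp {k}"
  using ak by (auto simp: nilp_def)

lemma det_torus: "x \<noteq> 0 \<Longrightarrow> det (torus x) = 1"
  by (subst torus_eq, assumption) (simp only: det_mul det_one_plus_nilp[OF munit_nilp(1)]
      det_one_plus_nilp[OF munit_nilp(2)] mult_1)

lemma elim_d_in_SLs:
  assumes k: "k \<in> S" and a: "a \<notin> S" and g: "g \<in> SLs (insert a S)" and x: "g $ a $ a \<noteq> 0"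
  shows "elim_d g \<in> SLs S"
proof -
  have "det g = det (elim_d g)"
    using arg_cong[OF elim_factorization[OF x], of det] det_torus[OF x] elim_nilp[of g]
    by (simp add: det_mul det_one_plus_nilp)
  moreover have "elim_d g $ i $ j = (if i = j then 1 else 0)" if "i \<notin> S \<or> j \<notin> S" for i j
    using that g k a by (auto simp: elim_d_def SLs_def)
  ultimately show ?thesis
    using g by (auto simp: SLs_def)
qed

lemma elim_function_ring:
  assumes R: "function_ring R" and g: "\<And>i j. (\<lambda>x. G x $ i $ j) \<in> R"
    and inv: "(\<lambda>x. inverse (G x $ a $ a)) \<in> R"
  shows "(\<lambda>x. elim_l (G x) $ i $ j) \<in> R" "(\<lambda>x. elim_u (G x) $ i $ j) \<in> R"
    "(\<lambda>x. elim_d (G x) $ i $ j) \<in> R"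
proof -
  have z: "(\<lambda>x. 0) \<in> R" "(\<lambda>x. 1) \<in> R" using function_ringD(1)[OF R] by auto
  show "(\<lambda>x. elim_l (G x) $ i $ j) \<in> R"
    by (cases "j = a \<and> i \<noteq> a") (auto simp: elim_l_def z intro!: function_ringD[OF R] g inv)
  show "(\<lambda>x. elim_u (G x) $ i $ j) \<in> R"
    by (cases "i = a \<and> j \<noteq> a") (auto simp: elim_u_def z intro!: function_ringD[OF R] g inv)
  have "(\<lambda>x. if i = k then G x $ a $ a else 1) \<in> R"
    by (cases "i = k") (auto simp: z g)
  then have "(\<lambda>x. (if i = k then G x $ a $ a else 1) *
      (G x $ i $ j - G x $ i $ a * (inverse (G x $ a $ a) * G x $ a $ j))) \<in> R"
    by (intro function_ringD[OF R] function_ring_diff[OF R] g inv)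
  then show "(\<lambda>x. elim_d (G x) $ i $ j) \<in> R"
    by (cases "i = a"; cases "j = a") (simp_all add: elim_d_def z)
qed

text \<open>Each factor of the elimination is replaced by its lift: truncated exponentials for
  elementary matrices, \<rho>' for the smaller block. The only denominators are powers of the
  pivot.\<close>

lemma chart_exists:
  fixes \<beta> :: "'r cmat \<Rightarrow> 'n::finite cmat"
  assumes conn: "invariant_conn \<beta>" and k: "k \<in> S" and a: "a \<notin> S"
    and poly: "\<And>i j. (\<lambda>g. \<rho>' g $ i $ j) \<in> polyfn" and int: "integrates_on \<beta> (SLs S) \<rho>'"
  shows "\<exists>\<rho>. (\<forall>i j. (\<lambda>g. \<rho> g $ i $ j) \<in> loc_polyfn (\<lambda>g. g $ a $ a)) \<and>
     integrates_on \<beta> {g \<in> SLs (insert a S). g $ a $ a \<noteq> 0} \<rho>"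
proof -
  obtain N where N: "nil_bound \<beta> N" using ex_nil_bound[OF conn] by blast
  define e where "e u = expn N (\<beta> u)" for u
  define eP where "eP x = e (msc x (munit a k))" for x
  define eQ where "eQ x = e (msc x (munit k a))" for x
  \<comment> \<open>The word of \<open>torus_eq\<close> with every elementary factor
    exponentiated.\<close>
  define \<tau> where "\<tau> x = eP x ** eQ (- inverse x) ** eP x ** (eP (- 1) ** eQ 1 ** eP (- 1))" for x
  define \<rho> where "\<rho> g = e (elim_l g) ** \<tau> (g $ a $ a) ** \<rho>' (elim_d g) ** e (elim_u g)" for g
  have "(\<lambda>g. \<rho> g $ i $ j) \<in> loc_polyfn (\<lambda>g. g $ a $ a)" for i j
  proof -
    let ?R = "loc_polyfn (\<lambda>g::'r cmat. g $ a $ a)"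
    have R: "function_ring ?R" by (intro function_ring_loc_polyfn polyfn.intros)
    have c: "(\<lambda>g. g $ i $ j) \<in> ?R" for i j by (intro polyfn_subset_loc polyfn.intros)
    have inv: "(\<lambda>g. inverse (g $ a $ a)) \<in> ?R" by (rule inverse_in_loc_polyfn)
    have e: "(\<lambda>g. e (F g) $ i $ j) \<in> ?R" if "\<And>i j. (\<lambda>g. F g $ i $ j) \<in> ?R" for F i j
      unfolding e_def by (intro function_ring_expn[OF R] function_ring_conn[OF conn R] that)
    have eP: "(\<lambda>g. eP (f g) $ i $ j) \<in> ?R" and eQ: "(\<lambda>g. eQ (f g) $ i $ j) \<in> ?R"
      if "f \<in> ?R" for f i j
      unfolding eP_def eQ_def using that
      by (auto intro!: e function_ringD(3)[OF R] function_ringD(1)[OF R] simp del: munit_nth)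
    show ?thesis
      unfolding \<rho>_def \<tau>_def
      by (intro function_ring_matrix_mult[OF R] e eP eQ elim_function_ring[OF R] c inv
          function_ring_minus[OF R] function_ringD(1)[OF R] polyfn_compose[OF poly R])
  qed
  moreover have "integrates_on \<beta> {g \<in> SLs (insert a S). g $ a $ a \<noteq> 0} \<rho>"
    unfolding integrates_on_def
  proof (intro allI impI)
    fix \<gamma> D t
    assume ev: "\<forall>\<^sub>F s in nhds t. \<gamma> s \<in> {g \<in> SLs (insert a S). g $ a $ a \<noteq> 0}" and D: "mderiv \<gamma> D t"
    let ?R = "{f::complex \<Rightarrow> complex. f field_differentiable at t}"
    have R: "function_ring ?R" by (rule function_ring_field_differentiable)
    have c: "(\<lambda>s. \<gamma> s $ i $ j) \<in> ?R" for i j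
      using mderivD[OF D] unfolding mem_Collect_eq field_differentiable_def by blast
    have nz: "\<gamma> t $ a $ a \<noteq> 0" using eventually_nhds_x_imp_x[OF ev] by simp
    have inv: "(\<lambda>s. inverse (\<gamma> s $ a $ a)) \<in> ?R"
      using c nz by (auto intro: field_differentiable_inverse)
    have d: "\<exists>D. mderiv F D t" if "\<And>i j. (\<lambda>s. F s $ i $ j) \<in> ?R" for F :: "complex \<Rightarrow> 'r cmat"
      using that by (intro mderiv_ex) auto
    have el: "lifts \<beta> (\<lambda>s. mat 1 + u s) (\<lambda>s. e (u s)) t"
      if "\<And>s. u s \<in> nilp I" "\<And>i j. (\<lambda>s. u s $ i $ j) \<in> ?R" for u I
    proof -
      from d[of u, OF that(2)] obtain u' where "mderiv u u' t" by blast
      then show ?thesis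
        unfolding e_def by (rule lifts_elementary[OF conn N that(1)])
    qed
    have m: "(\<lambda>s. msc (f s) (munit p q) $ i $ j) \<in> ?R" if "f \<in> ?R" for f p q i j
      unfolding msc_nth by (intro function_ringD(3)[OF R] that function_ringD(1)[OF R])
    have P: "lifts \<beta> (\<lambda>s. mat 1 + msc (f s) (munit a k)) (\<lambda>s. eP (f s)) t" if "f \<in> ?R" for f
      unfolding eP_def by (rule el) (rule munit_nilp m that)+
    have Q: "lifts \<beta> (\<lambda>s. mat 1 + msc (f s) (munit k a)) (\<lambda>s. eQ (f s)) t" if "f \<in> ?R" for f
      unfolding eQ_def by (rule el) (rule munit_nilp m that)+
    have T: "lifts \<beta> (\<lambda>s. (mat 1 + msc (\<gamma> s $ a $ a) (munit a k)) **
        (mat 1 + msc (- inverse (\<gamma> s $ a $ a)) (munit k a)) ** (mat 1 + msc (\<gamma> s $ a $ a) (munit a k)) **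
        ((mat 1 + msc (- 1) (munit a k)) ** (mat 1 + msc 1 (munit k a)) ** (mat 1 + msc (- 1) (munit a k))))
        (\<lambda>s. \<tau> (\<gamma> s $ a $ a)) t"
      unfolding \<tau>_def
      by (intro lifts_mult[OF conn] P Q c function_ring_minus[OF R] inv function_ringD(1)[OF R])
    have "\<forall>\<^sub>F s in nhds t. elim_d (\<gamma> s) \<in> SLs S"
      using ev by eventually_elim (auto intro: elim_d_in_SLs[OF k a])
    then have d': "lifts \<beta> (\<lambda>s. elim_d (\<gamma> s)) (\<lambda>s. \<rho>' (elim_d (\<gamma> s))) t"
      by (rule integrates_onD[OF int _ d[OF elim_function_ring(3)[OF R c inv]]])
    show "lifts \<beta> \<gamma> (\<lambda>s. \<rho> (\<gamma> s)) t"
    proof (rule lifts_cong)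
      show "lifts \<beta> (\<lambda>s. (mat 1 + elim_l (\<gamma> s)) ** ((mat 1 + msc (\<gamma> s $ a $ a) (munit a k)) **
        (mat 1 + msc (- inverse (\<gamma> s $ a $ a)) (munit k a)) ** (mat 1 + msc (\<gamma> s $ a $ a) (munit a k)) **
        ((mat 1 + msc (- 1) (munit a k)) ** (mat 1 + msc 1 (munit k a)) ** (mat 1 + msc (- 1) (munit a k)))) **
        elim_d (\<gamma> s) ** (mat 1 + elim_u (\<gamma> s)))
        (\<lambda>s. e (elim_l (\<gamma> s)) ** \<tau> (\<gamma> s $ a $ a) ** \<rho>' (elim_d (\<gamma> s)) ** e (elim_u (\<gamma> s))) t"
        by (intro lifts_mult[OF conn] T d' el[OF elim_nilp(1)] el[OF elim_nilp(2)]
            elim_function_ring[OF R c inv])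
      show "\<forall>\<^sub>F s in nhds t. (mat 1 + elim_l (\<gamma> s)) ** ((mat 1 + msc (\<gamma> s $ a $ a) (munit a k)) **
        (mat 1 + msc (- inverse (\<gamma> s $ a $ a)) (munit k a)) ** (mat 1 + msc (\<gamma> s $ a $ a) (munit a k)) **
        ((mat 1 + msc (- 1) (munit a k)) ** (mat 1 + msc 1 (munit k a)) ** (mat 1 + msc (- 1) (munit a k)))) **
        elim_d (\<gamma> s) ** (mat 1 + elim_u (\<gamma> s)) = \<gamma> s"
        using ev
      proof eventually_elim
        case (elim s)
        then show ?case
          using elim_factorization[of "\<gamma> s", symmetric] torus_eq[of "\<gamma> s $ a $ a"] by simp
      qed
    qed (simp add: \<rho>_def)
  qed
  ultimately show ?thesis by blast
qed

end

subsection \<open>Integrating a representation to a polynomial map on the special linear group\<close>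

text \<open>The straight line from the identity to \<open>g\<close>, with column \<open>k\<close>
  divided by the determinant to return to determinant 1. The exceptional set is the zero set of that
  determinant, a polynomial in z equal to 1 at both ends. The other columns stay affine in z, which
  later controls the pivots along the curve.\<close>

lemma connecting_curve:
  assumes k: "k \<in> S" and g: "g \<in> SLs S"
  obtains \<gamma> Z where "finite Z" "0 \<notin> Z" "1 \<notin> Z" "\<gamma> 0 = mat 1" "\<gamma> 1 = g"
    "\<And>z. z \<notin> Z \<Longrightarrow> \<gamma> z \<in> SLs S" "\<And>z. z \<notin> Z \<Longrightarrow> \<exists>D. mderiv \<gamma> D z"
    "\<And>z i j. j \<noteq> k \<Longrightarrow> \<gamma> z $ i $ j = (1 - z) * (if i = j then 1 else 0) + z * g $ i $ j"
proof -
  define M :: "complex \<Rightarrow> 'a cmat" where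
    "M z = (\<chi> i j. (1 - z) * (if i = j then 1 else 0) + z * g $ i $ j)" for z
  define T :: "complex \<Rightarrow> 'a cmat" where
    "T z = (\<chi> i j. if i = j then (if j = k then inverse (det (M z)) else 1) else 0)" for z
  define \<gamma> where "\<gamma> z = M z ** T z" for z
  define Z where "Z = {z. det (M z) = 0}"
  have \<gamma>: "\<gamma> z $ i $ j = M z $ i $ j * (if j = k then inverse (det (M z)) else 1)" for z i j
    unfolding \<gamma>_def T_def matrix_matrix_mult_def by (simp add: mult_delta_right)
  have M01: "M 0 = mat 1" "M 1 = g"
    by (auto simp: vec_eq_iff M_def mat_def)
  have det01: "det (M 0) = 1" "det (M 1) = 1"
    using g by (auto simp: M01 SLs_def)
  have Mring: "(\<lambda>z. M z $ i $ j) \<in> R" if R: "function_ring R" and "(\<lambda>z. z) \<in> R" for R i j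
    unfolding M_def vec_lambda_beta
    by (intro function_ringD[OF R] function_ring_diff[OF R] that)
  have "(\<lambda>z. z) = poly [:0, 1 :: complex:]"
    by auto
  then have "(\<lambda>z::complex. z) \<in> {f. \<exists>q. f = poly q}"
    by blast
  then have "(\<lambda>z. det (M z)) \<in> {f. \<exists>q. f = poly q}"
    by (intro function_ring_det function_ring_poly Mring)
  then obtain q where q: "(\<lambda>z. det (M z)) = poly q" by auto
  then have "q \<noteq> 0" using fun_cong[OF q, of 0] det01 by auto
  then have fin: "finite Z" using poly_roots_finite[of q] fun_cong[OF q] by (simp add: Z_def)
  have curve: "\<gamma> z \<in> SLs S \<and> (\<exists>D. mderiv \<gamma> D z)" if z: "z \<notin> Z" for z
  proof
    have "det (T z) = inverse (det (M z))"
      by (subst det_diagonal) (auto simp: T_def)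
    then have "det (\<gamma> z) = 1" using z by (simp add: \<gamma>_def det_mul Z_def)
    moreover have "\<gamma> z $ i $ j = (if i = j then 1 else 0)" if "i \<notin> S \<or> j \<notin> S" for i j
      using that g k unfolding \<gamma> by (auto simp: M_def SLs_def)
    ultimately show "\<gamma> z \<in> SLs S" by (simp add: SLs_def)
    let ?R = "{f::complex \<Rightarrow> complex. f field_differentiable at z}"
    have R: "function_ring ?R" by (rule function_ring_field_differentiable)
    have "(\<lambda>z. z) \<in> ?R" using field_differentiable_ident by (simp add: id_def)
    note Mr = Mring[OF R this]
    have "(\<lambda>z. inverse (det (M z))) \<in> ?R"
      using function_ring_det[OF R Mr] z by (auto intro: field_differentiable_inverse simp: Z_def)
    then have "(\<lambda>z. if j = k then inverse (det (M z)) else 1) \<in> ?R" for j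
      by (cases "j = k") auto
    then have "(\<lambda>z. \<gamma> z $ i $ j) \<in> ?R" for i j
      unfolding \<gamma> by (intro function_ringD(3)[OF R] Mr)
    then show "\<exists>D. mderiv \<gamma> D z" by (intro mderiv_ex) auto
  qed
  have "\<gamma> 0 = mat 1" "\<gamma> 1 = g" "0 \<notin> Z" "1 \<notin> Z"
    using det01 by (auto simp: vec_eq_iff \<gamma> M01 Z_def)
  moreover have "\<gamma> z $ i $ j = (1 - z) * (if i = j then 1 else 0) + z * g $ i $ j" if "j \<noteq> k" for z i j
    using that unfolding \<gamma> by (simp add: M_def)
  ultimately show ?thesis
    using that[of Z \<gamma>] fin curve by auto
qed

text \<open>The contragredient representation. The transpose of its solution will be the inverse of
  the solution for \<beta>.\<close>

definition dual_conn :: "('r::finite cmat \<Rightarrow> 'n::finite cmat) \<Rightarrow> 'r cmat \<Rightarrow> 'n cmat" where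
  "dual_conn \<beta> A = - transpose (\<beta> A)"

lemma transpose_msc: "transpose (msc c A) = msc c (transpose A)"
  and transpose_add: "transpose (A + B :: complex^'n^'n) = transpose A + transpose B"
  and transpose_diff: "transpose (A - B :: complex^'n^'n) = transpose A - transpose B"
  and transpose_minus: "transpose (- A :: complex^'n^'n) = - transpose A"
  by (simp_all add: vec_eq_iff transpose_def)

lemma invariant_conn_dual:
  assumes "invariant_conn \<beta>"
  shows "invariant_conn (dual_conn \<beta>)"
  unfolding invariant_conn_def dual_conn_def
  by (simp add: conn_add[OF assms] conn_msc[OF assms] conn_bracket[OF assms] transpose_add
      transpose_msc transpose_diff matrix_transpose_mul mat_algebra)

lemma integrates_on_subset: "integrates_on \<beta> X \<rho> \<Longrightarrow> Y \<subseteq> X \<Longrightarrow> integrates_on \<beta> Y \<rho>"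
  unfolding integrates_on_def by (blast intro: eventually_mono)

lemma mderiv_dual:
  assumes "lifts \<beta> \<gamma> y t" "lifts (dual_conn \<beta>) \<gamma> z t" "mderiv \<gamma> (\<gamma> t ** B) t"
  shows "mderiv (\<lambda>s. transpose (z s)) (- (\<beta> B ** transpose (z t))) t"
  using mderiv_transpose[OF lifts_unique_B[OF assms(2,3)]]
  by (simp add: dual_conn_def matrix_transpose_mul transpose_minus mat_algebra)

text \<open>Along the curve \<rho>' = \<rho> \<beta>(B), while the transpose of \<sigma> has
  derivative - \<beta>(B) times itself. The two terms of the product rule cancel, so the product
  keeps its initial value.\<close>

lemma integrates_dual_inverse:
  assumes r: "integrates_on \<beta> X \<rho>" and q: "integrates_on (dual_conn \<beta>) X \<sigma>"
    and Z: "finite Z" "0 \<notin> Z" "1 \<notin> Z"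
    and \<gamma>: "\<And>z. z \<notin> Z \<Longrightarrow> \<gamma> z \<in> X" "\<And>z. z \<notin> Z \<Longrightarrow> \<exists>D. mderiv \<gamma> D z"
    and 0: "\<rho> (\<gamma> 0) ** transpose (\<sigma> (\<gamma> 0)) = mat 1"
  shows "\<rho> (\<gamma> 1) ** transpose (\<sigma> (\<gamma> 1)) = mat 1"
proof -
  have "mderiv (\<lambda>z. \<rho> (\<gamma> z) ** transpose (\<sigma> (\<gamma> z))) 0 z" if z: "z \<notin> Z" for z
  proof -
    have "open (- Z)" using Z by (simp add: finite_imp_closed open_Compl)
    then have "\<forall>\<^sub>F s in nhds z. s \<in> - Z" using z by (intro eventually_nhds_in_open) auto
    then have ev: "\<forall>\<^sub>F s in nhds z. \<gamma> s \<in> X" by eventually_elim (use \<gamma> in auto)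
    have l: "lifts \<beta> \<gamma> (\<lambda>s. \<rho> (\<gamma> s)) z" "lifts (dual_conn \<beta>) \<gamma> (\<lambda>s. \<sigma> (\<gamma> s)) z"
      by (rule integrates_onD[OF r ev \<gamma>(2)[OF z]], rule integrates_onD[OF q ev \<gamma>(2)[OF z]])
    then obtain B where B: "mderiv \<gamma> (\<gamma> z ** B) z" "mderiv (\<lambda>s. \<rho> (\<gamma> s)) (\<rho> (\<gamma> z) ** \<beta> B) z"
      unfolding lifts_def by blast
    show ?thesis
      using mderiv_mult[OF B(2) mderiv_dual[OF l B(1)]] by (simp add: mat_algebra)
  qed
  from mderiv_zero_imp_eq[OF Z this] 0 show ?thesis by simp
qed

text \<open>The functions \<open>h\<close> for which \<open>h F\<close> is polynomial form an ideal whose radical contains all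
  \<open>p i\<close>, hence \<open>1\<close>.\<close>

lemma polyfn_of_local:
  fixes p u :: "'i \<Rightarrow> 'r::finite cmat \<Rightarrow> complex"
  assumes I: "finite I" and p: "\<And>i. p i \<in> polyfn" and u: "\<And>i. u i \<in> polyfn"
    and unit: "\<And>g. g \<in> X \<Longrightarrow> (\<Sum>i\<in>I. u i g * p i g) = 1"
    and loc: "\<And>i. i \<in> I \<Longrightarrow> \<exists>G\<in>loc_polyfn (p i). \<forall>g\<in>X. p i g \<noteq> 0 \<longrightarrow> F g = G g"
  shows "\<exists>P\<in>polyfn. \<forall>g\<in>X. F g = P g"
proof -
  note pr = function_ring_intros[OF function_ring_polyfn]
  define J where "J h \<longleftrightarrow> (\<exists>P\<in>polyfn. \<forall>g\<in>X. h g * F g = P g)" for h :: "'r cmat \<Rightarrow> complex"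
  have J_add: "J (\<lambda>g. f g + h g)" if "J f" "J h" for f h
  proof -
    from that obtain P Q where
      "P \<in> polyfn" "Q \<in> polyfn" "\<forall>g\<in>X. f g * F g = P g" "\<forall>g\<in>X. h g * F g = Q g"
      unfolding J_def by blast
    then show ?thesis
      unfolding J_def by (intro bexI[of _ "\<lambda>g. P g + Q g"] pr) (auto simp: distrib_right)
  qed
  have J_mult: "J (\<lambda>g. f g * h g)" if "f \<in> polyfn" "J h" for f h
  proof -
    from that obtain P where "f \<in> polyfn" "P \<in> polyfn" "\<forall>g\<in>X. h g * F g = P g"
      unfolding J_def by blast
    then show ?thesis
      unfolding J_def by (intro bexI[of _ "\<lambda>g. f g * P g"] pr) (auto simp: mult.assoc)
  qed
  \<comment> \<open>Radicals are closed under sums: splitting off one factor x + y moves x or y into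
    \<open>z\<close> and lowers \<open>N\<close> or \<open>M\<close>. The spare multiplier
    \<open>z\<close> makes the induction possible.\<close>
  have J_binom: "J (\<lambda>g. (x g + y g) ^ (N + M) * z g)"
    if "x \<in> polyfn" "y \<in> polyfn" "z \<in> polyfn" "J (\<lambda>g. x g ^ N * z g)" "J (\<lambda>g. y g ^ M * z g)"
    for x y z N M
    using that(3-)
  proof (induction "N + M" arbitrary: N M z)
    case 0
    then show ?case by simp
  next
    case (Suc n)
    show ?case
    proof (cases "N = 0 \<or> M = 0")
      case True
      then have "J z" using Suc.prems by auto
      then show ?thesis by (intro J_mult pr that(1,2))
    next
      case False
      then obtain N' M' where NM: "N = Suc N'" "M = Suc M'" by (metis not0_implies_Suc)
      have "J (\<lambda>g. (x g + y g) ^ (N' + M) * (x g * z g))"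
      proof (rule Suc.hyps(1))
        have "J (\<lambda>g. x g * (y g ^ M * z g))" by (rule J_mult[OF that(1) Suc.prems(3)])
        then show "J (\<lambda>g. y g ^ M * (x g * z g))" by (simp add: mult_ac)
        show "J (\<lambda>g. x g ^ N' * (x g * z g))" using Suc.prems(2) by (simp add: NM mult_ac)
      qed (use Suc NM that in \<open>auto intro: polyfn.intros\<close>)
      moreover have "J (\<lambda>g. (x g + y g) ^ (N + M') * (y g * z g))"
      proof (rule Suc.hyps(1))
        have "J (\<lambda>g. y g * (x g ^ N * z g))" by (rule J_mult[OF that(2) Suc.prems(2)])
        then show "J (\<lambda>g. x g ^ N * (y g * z g))" by (simp add: mult_ac)
        show "J (\<lambda>g. y g ^ M' * (y g * z g))" using Suc.prems(3) by (simp add: NM mult_ac)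
      qed (use Suc NM that in \<open>auto intro: polyfn.intros\<close>)
      ultimately have "J (\<lambda>g. (x g + y g) ^ (N' + M) * (x g * z g) + (x g + y g) ^ (N + M') * (y g * z g))"
        by (rule J_add)
      then show ?thesis by (simp add: NM algebra_simps)
    qed
  qed
  define Rad where "Rad h \<longleftrightarrow> h \<in> polyfn \<and> (\<exists>N. J (\<lambda>g. h g ^ N))" for h
  have Rad_add: "Rad (\<lambda>g. x g + y g)" if xy: "Rad x" "Rad y" for x y
  proof -
    obtain N M where NM: "J (\<lambda>g. x g ^ N * 1)" "J (\<lambda>g. y g ^ M * 1)" "x \<in> polyfn" "y \<in> polyfn"
      using xy unfolding Rad_def by auto
    from J_binom[OF NM(3,4) polyfn.const NM(1,2)] NM(3,4) show ?thesis
      unfolding Rad_def by (auto intro: polyfn.intros)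
  qed
  have Rad_mult: "Rad (\<lambda>g. f g * x g)" if f: "f \<in> polyfn" and x: "Rad x" for f x
  proof -
    obtain N where "J (\<lambda>g. x g ^ N)" "x \<in> polyfn" using x unfolding Rad_def by auto
    then have "J (\<lambda>g. f g ^ N * x g ^ N)" "(\<lambda>g. f g * x g) \<in> polyfn"
      using f by (auto intro: J_mult pr)
    then show ?thesis unfolding Rad_def power_mult_distrib[symmetric] by blast
  qed
  have Rad_p: "Rad (p i)" if i: "i \<in> I" for i
  proof -
    obtain G where G: "G \<in> loc_polyfn (p i)" "\<forall>g\<in>X. p i g \<noteq> 0 \<longrightarrow> F g = G g"
      using loc[OF i] by blast
    then obtain P N where P: "P \<in> polyfn" "\<forall>g. p i g \<noteq> 0 \<longrightarrow> G g * p i g ^ N = P g"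
      unfolding loc_polyfn_def by blast
    \<comment> \<open>One power more than the denominator requires: where \<open>p i\<close>
      vanishes nothing is known about \<open>F\<close>, and the extra factor makes both sides zero
      there.\<close>
    have "p i g ^ Suc N * F g = p i g * P g" if "g \<in> X" for g
      using G(2) P(2) that by (cases "p i g = 0") (auto simp: mult_ac)
    then have "J (\<lambda>g. p i g ^ Suc N)"
      unfolding J_def by (intro bexI[of _ "\<lambda>g. p i g * P g"] polyfn.mult p P(1)) auto
    then show ?thesis unfolding Rad_def using p by blast
  qed
  have "Rad (\<lambda>g. \<Sum>i\<in>K. u i g * p i g)" if "K \<subseteq> I" for K
    using finite_subset[OF that I] that
  proof (induction K rule: finite_induct)
    case empty
    have "J (\<lambda>g. 0 ^ 1)" unfolding J_def by (auto intro: polyfn.const)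
    then show ?case unfolding Rad_def sum.empty using polyfn.const by blast
  next
    case (insert i K)
    then show ?case using Rad_add[OF Rad_mult[OF u Rad_p]] by simp
  qed
  from this[of I] obtain N where "J (\<lambda>g. (\<Sum>i\<in>I. u i g * p i g) ^ N)"
    unfolding Rad_def by auto
  then show ?thesis unfolding J_def using unit by simp
qed

section \<open>Charts on the special linear group and their gluing\<close>

definition sl_integrable :: "('r::finite cmat \<Rightarrow> 'n::finite cmat) \<Rightarrow> 'r set \<Rightarrow> bool" where
  "sl_integrable \<beta> S \<longleftrightarrow> (\<exists>\<rho>. (\<forall>i j. (\<lambda>g. \<rho> g $ i $ j) \<in> polyfn) \<and> \<rho> (mat 1) = mat 1 \<and>
     integrates_on \<beta> (SLs S) \<rho>)"

lemma one_in_SLs: "mat 1 \<in> SLs S"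
  unfolding SLs_def by simp (simp add: mat_def)

lemma SLs_mult:
  assumes g: "g \<in> SLs S" and h: "h \<in> SLs S"
  shows "g ** h \<in> SLs S"
proof -
  have "(g ** h) $ i $ j = (if i = j then 1 else 0)" if "i \<notin> S \<or> j \<notin> S" for i j
  proof (cases "i \<in> S")
    case True
    then have "h $ m $ j = (if m = j then 1 else 0)" for m
      using that h by (auto simp: SLs_def)
    then have "(g ** h) $ i $ j = g $ i $ j"
      by (simp add: matrix_matrix_mult_def mult_delta_right)
    then show ?thesis using that g by (auto simp: SLs_def)
  next
    case False
    then have "g $ i $ m = (if i = m then 1 else 0)" for m
      using g by (auto simp: SLs_def)
    then have "(g ** h) $ i $ j = h $ i $ j"
      by (simp add: matrix_matrix_mult_def mult_delta_left)
    then show ?thesis using that h False by (auto simp: SLs_def)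
  qed
  then show ?thesis
    using g h by (auto simp: SLs_def det_mul)
qed

text \<open>The group is trivial: a single free diagonal entry is forced to be 1 by the
  determinant.\<close>

lemma sl_integrable_singleton:
  fixes \<beta> :: "'a::finite cmat \<Rightarrow> 'n::finite cmat"
  assumes conn: "invariant_conn \<beta>"
  shows "sl_integrable \<beta> {k}"
  unfolding sl_integrable_def
proof (intro exI[of _ "\<lambda>g. mat 1"] conjI allI)
  show "(\<lambda>g. mat 1 $ i $ j) \<in> polyfn" for i j by (rule polyfn.const)
  have one: "g = mat 1" if g: "g \<in> SLs {k}" for g :: "'a cmat"
  proof -
    have e: "g $ i $ j = (if i = j then 1 else 0)" if "i \<noteq> k \<or> j \<noteq> k" for i j
      using g that by (auto simp: SLs_def)
    have "det g = (\<Prod>i\<in>UNIV. g $ i $ i)"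
      by (rule det_diagonal) (use e in metis)
    also have "\<dots> = (\<Prod>i\<in>UNIV. if i = k then g $ k $ k else 1)"
      by (intro prod.cong refl) (use e in auto)
    finally have "g $ k $ k = 1" using g by (simp add: SLs_def)
    with e have "g $ i $ j = (if i = j then 1 else 0)" for i j by (cases "i = k \<and> j = k") auto
    then show ?thesis by (simp add: vec_eq_iff mat_def)
  qed
  show "integrates_on \<beta> (SLs {k}) (\<lambda>g. mat 1)"
    unfolding integrates_on_def
  proof (intro allI impI)
    fix \<gamma> :: "complex \<Rightarrow> 'a cmat" and D t
    assume ev: "\<forall>\<^sub>F s in nhds t. \<gamma> s \<in> SLs {k}"
    show "lifts \<beta> \<gamma> (\<lambda>s. mat 1) t"
    proof (rule lifts_cong)
      show "lifts \<beta> (\<lambda>s. mat 1) (\<lambda>s. mat 1) t" by (rule lifts_const[OF adm_one conn])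
      show "\<forall>\<^sub>F s in nhds t. mat 1 = \<gamma> s" using ev by eventually_elim (auto dest: one)
    qed simp
  qed
qed simp

text \<open>The sets \<open>pivot a i \<noteq> 0\<close> are the left translates by \<open>shear a i\<close> of the chart
  \<open>g $ a $ a \<noteq> 0\<close>. All of them contain the identity, where the local solutions are normalised.\<close>

definition shear :: "'r::finite \<Rightarrow> 'r \<Rightarrow> 'r cmat" where
  "shear a i = mat 1 + (if i = a then 0 else munit a i)"

definition pivot :: "'r::finite \<Rightarrow> 'r \<Rightarrow> 'r cmat \<Rightarrow> complex" where
  "pivot a i g = (shear a i ** g) $ a $ a"

lemma pivot_eq: "pivot a i g = g $ a $ a + (if i = a then 0 else g $ i $ a)"
  by (auto simp: pivot_def shear_def mat_algebra matrix_matrix_mult_def[of "munit a i"] mult_delta_left)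

lemma pivot_polyfn: "pivot a i \<in> polyfn"
proof -
  have "(\<lambda>g. g $ a $ a + (if i = a then 0 else g $ i $ a)) \<in> polyfn"
    by (cases "i = a") (auto intro!: polyfn.intros)
  then show ?thesis by (simp add: pivot_eq[abs_def])
qed

lemma shear_in_SLs:
  assumes "i \<in> S" "a \<in> S"
  shows "shear a i \<in> SLs S"
proof -
  have "(if i = a then 0 else munit a i) \<in> nilp {a}" by (auto simp: nilp_def)
  then have "det (shear a i) = 1" unfolding shear_def by (rule det_one_plus_nilp)
  then show ?thesis using assms by (auto simp: SLs_def shear_def mat_def)
qed

text \<open>Cofactor expansion along column \<open>a\<close>, rewritten through g_ia = pivot_i -
  pivot_a for i in \<open>S\<close>; this is why the coefficient at \<open>a\<close> loses the sum
  of the others.\<close>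

lemma pivot_unit_ideal:
  assumes "finite S" "a \<notin> S"
  shows "\<exists>u. (\<forall>i. u i \<in> polyfn) \<and> (\<forall>g\<in>SLs (insert a S). (\<Sum>i\<in>insert a S. u i g * pivot a i g) = 1)"
proof -
  obtain v where v: "\<And>i. v i \<in> polyfn"
    "\<And>g::'a cmat. det g = 1 \<Longrightarrow> (\<Sum>i\<in>UNIV. v i g * g $ i $ a) = 1"
    using matrix_inv_row_polyfn by blast
  define u where "u i = (if i = a then (\<lambda>g. v a g - (\<Sum>i\<in>S. v i g)) else v i)" for i
  have "u i \<in> polyfn" for i
    unfolding u_def by (auto intro!: function_ring_intros[OF function_ring_polyfn] v)
  moreover have "(\<Sum>i\<in>insert a S. u i g * pivot a i g) = 1" if g: "g \<in> SLs (insert a S)" for g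
  proof -
    have "(\<Sum>i\<in>S. u i g * pivot a i g) = (\<Sum>i\<in>S. v i g * g $ a $ a + v i g * g $ i $ a)"
      using assms by (intro sum.cong refl) (auto simp: u_def pivot_eq algebra_simps)
    then have "(\<Sum>i\<in>insert a S. u i g * pivot a i g) = (\<Sum>i\<in>insert a S. v i g * g $ i $ a)"
      using assms by (simp add: u_def pivot_eq sum.distrib algebra_simps flip: sum_distrib_right)
    also have "\<dots> = (\<Sum>i\<in>UNIV. v i g * g $ i $ a)"
      using g assms by (intro sum.mono_neutral_left) (auto simp: SLs_def)
    finally show ?thesis using v(2) g by (simp add: SLs_def)
  qed
  ultimately show ?thesis by blast
qed

lemma translated_charts:
  fixes \<beta> :: "'r::finite cmat \<Rightarrow> 'n::finite cmat"
  assumes conn: "invariant_conn \<beta>" and k: "k \<in> S" and a: "a \<notin> S" and IH: "sl_integrable \<beta> S"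
  shows "\<exists>r. \<forall>i\<in>insert a S. (\<forall>l m. (\<lambda>g. r i g $ l $ m) \<in> loc_polyfn (pivot a i)) \<and> r i (mat 1) = mat 1 \<and>
    integrates_on \<beta> {g \<in> SLs (insert a S). pivot a i g \<noteq> 0} (r i)"
proof -
  have ak: "a \<noteq> k" using k a by auto
  obtain \<rho>' where "\<And>i j. (\<lambda>g. \<rho>' g $ i $ j) \<in> polyfn" "integrates_on \<beta> (SLs S) \<rho>'"
    using IH unfolding sl_integrable_def by blast
  from chart_exists[OF ak conn k a this] obtain \<rho>
    where loc: "\<And>i j. (\<lambda>g. \<rho> g $ i $ j) \<in> loc_polyfn (\<lambda>g. g $ a $ a)"
      and int: "integrates_on \<beta> {g \<in> SLs (insert a S). g $ a $ a \<noteq> 0} \<rho>" by blast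
  define w where "w i = shear a i" for i
  \<comment> \<open>Constant left factors do not change the logarithmic derivative; the inverse in
    front normalises the value at the identity to 1.\<close>
  define r where "r i g = matrix_inv (\<rho> (w i)) ** \<rho> (w i ** g)" for i g
  have "(\<forall>l m. (\<lambda>g. r i g $ l $ m) \<in> loc_polyfn (pivot a i)) \<and> r i (mat 1) = mat 1 \<and>
    integrates_on \<beta> {g \<in> SLs (insert a S). pivot a i g \<noteq> 0} (r i)" if i: "i \<in> insert a S" for i
  proof (intro conjI allI)
    have w: "w i \<in> SLs (insert a S)" unfolding w_def by (rule shear_in_SLs) (use i in auto)
    have waa: "w i $ a $ a = 1" by (auto simp: w_def shear_def mat_def)
    have "lifts \<beta> (\<lambda>s. w i) (\<lambda>s. \<rho> (w i)) 0"
      using w waa mderiv_const by (intro integrates_onD[OF int]) auto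
    then have adm: "adm \<beta> (w i) (\<rho> (w i))" by (simp add: lifts_def)
    then have inv: "matrix_inv (w i) ** w i = mat 1" "matrix_inv (\<rho> (w i)) ** \<rho> (w i) = mat 1"
      by (auto simp: adm_def invertible_mult_matrix_inv)
    show "r i (mat 1) = mat 1" by (simp add: r_def inv)
    show "(\<lambda>g. r i g $ l $ m) \<in> loc_polyfn (pivot a i)" for l m
    proof -
      have R: "function_ring (loc_polyfn (pivot a i))"
        by (rule function_ring_loc_polyfn[OF pivot_polyfn])
      have "(\<lambda>g. (w i ** g) $ p $ q) \<in> polyfn" for p q
        by (intro function_ring_matrix_mult function_ring_polyfn polyfn.intros)
      then have "(\<lambda>g. \<rho> (w i ** g) $ p $ q) \<in> loc_polyfn (pivot a i)" for p q
        using loc_polyfn_compose[OF loc, of "\<lambda>g. w i ** g" p q] by (simp add: pivot_def[abs_def] w_def)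
      then show ?thesis
        unfolding r_def by (intro function_ring_matrix_mult R function_ringD(1)[OF R])
    qed
    show "integrates_on \<beta> {g \<in> SLs (insert a S). pivot a i g \<noteq> 0} (r i)"
      unfolding integrates_on_def
    proof (intro allI impI)
      fix \<gamma> D t
      assume ev: "\<forall>\<^sub>F s in nhds t. \<gamma> s \<in> {g \<in> SLs (insert a S). pivot a i g \<noteq> 0}" and D: "mderiv \<gamma> D t"
      have "\<forall>\<^sub>F s in nhds t. w i ** \<gamma> s \<in> {g \<in> SLs (insert a S). g $ a $ a \<noteq> 0}"
        using ev by eventually_elim (auto simp: pivot_def w_def intro: SLs_mult[OF w[unfolded w_def]])
      moreover have "\<exists>D. mderiv (\<lambda>s. w i ** \<gamma> s) D t"
        using mderiv_mult[OF mderiv_const D] by blast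
      ultimately have "lifts \<beta> (\<lambda>s. w i ** \<gamma> s) (\<lambda>s. \<rho> (w i ** \<gamma> s)) t"
        by (rule integrates_onD[OF int])
      from lifts_mult[OF conn lifts_const[OF adm_inverse[OF adm] conn] this]
      show "lifts \<beta> \<gamma> (\<lambda>s. r i (\<gamma> s)) t"
        by (simp add: r_def matrix_mul_assoc inv)
    qed
  qed
  then show ?thesis by blast
qed

text \<open>The charts \<open>q\<close> of the dual representation compare the charts
  \<open>r\<close>: on an overlap both \<open>r i\<close> and \<open>r j\<close> are inverse to the
  transpose of \<open>q i\<close>, hence equal. This is why the hypothesis is assumed for the dual
  as well.\<close>

lemma sl_integrable_insert:
  fixes \<beta> :: "'r::finite cmat \<Rightarrow> 'n::finite cmat"
  assumes conn: "invariant_conn \<beta>" and k: "k \<in> S" and a: "a \<notin> S"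
    and IH: "sl_integrable \<beta> S" and IH': "sl_integrable (dual_conn \<beta>) S"
  shows "sl_integrable \<beta> (insert a S)"
proof -
  let ?S = "insert a S"
  obtain r where r_loc: "\<And>i l m. i \<in> ?S \<Longrightarrow> (\<lambda>g. r i g $ l $ m) \<in> loc_polyfn (pivot a i)"
    and r1: "\<And>i. i \<in> ?S \<Longrightarrow> r i (mat 1) = mat 1"
    and r: "\<And>i. i \<in> ?S \<Longrightarrow> integrates_on \<beta> {g \<in> SLs ?S. pivot a i g \<noteq> 0} (r i)"
    using translated_charts[OF conn k a IH] by blast
  obtain q where q1: "\<And>i. i \<in> ?S \<Longrightarrow> q i (mat 1) = mat 1"
    and q: "\<And>i. i \<in> ?S \<Longrightarrow> integrates_on (dual_conn \<beta>) {g \<in> SLs ?S. pivot a i g \<noteq> 0} (q i)"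
    using translated_charts[OF invariant_conn_dual[OF conn] k a IH'] by blast
  have inv: "r i g ** transpose (q j g) = mat 1"
    if i: "i \<in> ?S" and j: "j \<in> ?S" and g: "g \<in> SLs ?S" "pivot a i g \<noteq> 0" "pivot a j g \<noteq> 0" for i j g
  proof -
    obtain \<gamma> Z where Z: "finite Z" "0 \<notin> Z" "1 \<notin> Z" and \<gamma>01: "\<gamma> 0 = mat 1" "\<gamma> 1 = g"
      and \<gamma>: "\<And>z. z \<notin> Z \<Longrightarrow> \<gamma> z \<in> SLs ?S" "\<And>z. z \<notin> Z \<Longrightarrow> \<exists>D. mderiv \<gamma> D z"
      and col: "\<And>z i j. j \<noteq> k \<Longrightarrow> \<gamma> z $ i $ j = (1 - z) * (if i = j then 1 else 0) + z * g $ i $ j"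
      by (rule connecting_curve[OF insertI2[OF k] g(1)]) blast
    define X where "X = {g \<in> SLs ?S. pivot a i g \<noteq> 0 \<and> pivot a j g \<noteq> 0}"
    define Z' where "Z' = Z \<union> {z. pivot a i (\<gamma> z) = 0} \<union> {z. pivot a j (\<gamma> z) = 0}"
    have "a \<noteq> k" using k a by auto
    \<comment> \<open>Pivots only see column \<open>a\<close>, where the curve is affine. Each
      starts at 1 for z = 0, so it has at most one zero, and at z = 1 it is the pivot of
      \<open>g\<close>.\<close>
    then have pivot_\<gamma>: "pivot a i (\<gamma> z) = 1 + z * (pivot a i g - 1)" for i z
      by (simp add: pivot_eq col algebra_simps)
    have "finite {z. 1 + z * c = 0}" for c :: complex
    proof (rule finite_subset)
      show "{z. 1 + z * c = 0} \<subseteq> {- 1 / c}"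
      proof
        fix z assume "z \<in> {z. 1 + z * c = 0}"
        then have zc: "z * c = - 1" by (simp add: add_eq_0_iff)
        then have "c \<noteq> 0" by auto
        then have "z = z * c / c" by simp
        then show "z \<in> {- 1 / c}" by (simp add: zc)
      qed
    qed simp
    then have Z': "finite Z'" "0 \<notin> Z'" "1 \<notin> Z'"
      using Z g by (auto simp: Z'_def pivot_\<gamma>)
    have "r i (\<gamma> 1) ** transpose (q j (\<gamma> 1)) = mat 1"
    proof (rule integrates_dual_inverse[where \<gamma> = \<gamma> and X = X, OF _ _ Z'])
      show "integrates_on \<beta> X (r i)" "integrates_on (dual_conn \<beta>) X (q j)"
        by (rule integrates_on_subset[OF r[OF i]], force simp: X_def)
           (rule integrates_on_subset[OF q[OF j]], force simp: X_def)
      show "\<gamma> z \<in> X" "\<exists>D. mderiv \<gamma> D z" if "z \<notin> Z'" for z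
        using that \<gamma> by (auto simp: X_def Z'_def)
    qed (simp add: \<gamma>01 r1[OF i] q1[OF j] transpose_mat)
    then show ?thesis by (simp add: \<gamma>01)
  qed
  have agree: "r i g = r j g"
    if "i \<in> ?S" "j \<in> ?S" "g \<in> SLs ?S" "pivot a i g \<noteq> 0" "pivot a j g \<noteq> 0" for i j g
    by (rule matrix_left_imp_inv[OF inv[of i i g] inv[of j i g]]) (fact that)+
  obtain u where u: "\<And>i. u i \<in> polyfn"
     "\<And>g. g \<in> SLs ?S \<Longrightarrow> (\<Sum>i\<in>?S. u i g * pivot a i g) = 1"
    using pivot_unit_ideal[of S a] a by auto
  have cover: "\<exists>i. i \<in> ?S \<and> pivot a i g \<noteq> 0" if "g \<in> SLs ?S" for g
  proof (rule ccontr)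
    assume "\<nexists>i. i \<in> ?S \<and> pivot a i g \<noteq> 0"
    then have "(\<Sum>i\<in>?S. u i g * pivot a i g) = 0" by (intro sum.neutral) auto
    then show False using u(2)[OF that] by simp
  qed
  define F where "F g = r (SOME i. i \<in> ?S \<and> pivot a i g \<noteq> 0) g" for g
  have F: "F g = r i g" if "i \<in> ?S" "g \<in> SLs ?S" "pivot a i g \<noteq> 0" for i g
  proof -
    have "(SOME i. i \<in> ?S \<and> pivot a i g \<noteq> 0) \<in> ?S \<and> pivot a (SOME i. i \<in> ?S \<and> pivot a i g \<noteq> 0) g \<noteq> 0"
      by (rule someI_ex[OF cover[OF that(2)]])
    then show ?thesis unfolding F_def using that by (intro agree) simp_all
  qed
  have "\<exists>P\<in>polyfn. \<forall>g\<in>SLs ?S. F g $ l $ m = P g" for l m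
  proof (rule polyfn_of_local[OF _ pivot_polyfn u(1) u(2)])
    show "\<exists>G\<in>loc_polyfn (pivot a i). \<forall>g\<in>SLs ?S. pivot a i g \<noteq> 0 \<longrightarrow> F g $ l $ m = G g"
      if "i \<in> ?S" for i
      using F[OF that] r_loc[OF that] by (intro bexI[of _ "\<lambda>g. r i g $ l $ m"]) auto
  qed auto
  then obtain P where P: "\<And>l m. P l m \<in> polyfn" "\<And>l m g. g \<in> SLs ?S \<Longrightarrow> F g $ l $ m = P l m g"
    by metis
  define \<rho> where "\<rho> g = (\<chi> l m. P l m g)" for g
  have \<rho>: "\<rho> g = F g" if "g \<in> SLs ?S" for g
    using P(2)[OF that] by (simp add: \<rho>_def vec_eq_iff)
  have "\<rho> (mat 1) = mat 1"
    using \<rho>[OF one_in_SLs] F[of a "mat 1"] r1[of a] one_in_SLs[of ?S] by (simp add: pivot_eq mat_def)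
  moreover have "integrates_on \<beta> (SLs ?S) \<rho>"
    unfolding integrates_on_def
  proof (intro allI impI)
    fix \<gamma> D t assume ev: "\<forall>\<^sub>F s in nhds t. \<gamma> s \<in> SLs ?S" and D: "mderiv \<gamma> D t"
    obtain i where i: "i \<in> ?S" "pivot a i (\<gamma> t) \<noteq> 0"
      using cover[OF eventually_nhds_x_imp_x[OF ev]] by blast
    \<comment> \<open>A nonzero pivot stays nonzero near \<open>t\<close>, so a single chart
      computes \<rho> along the curve there.\<close>
    have "isCont (\<lambda>s. pivot a i (\<gamma> s)) t"
      by (cases "i = a") (auto simp: pivot_eq intro!: continuous_intros mderiv_imp_isCont[OF D])
    then have "\<forall>\<^sub>F s in nhds t. pivot a i (\<gamma> s) \<noteq> 0"
      using i(2) by (simp add: eventually_nhds_conv_at isCont_def tendsto_imp_eventually_ne)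
    with ev have ev': "\<forall>\<^sub>F s in nhds t. \<gamma> s \<in> {g \<in> SLs ?S. pivot a i g \<noteq> 0}"
      by eventually_elim auto
    have lift: "lifts \<beta> \<gamma> (\<lambda>s. r i (\<gamma> s)) t"
      using ev' D by (intro integrates_onD[OF r[OF i(1)]]) auto
    have "\<forall>\<^sub>F s in nhds t. r i (\<gamma> s) = \<rho> (\<gamma> s)"
      using ev' by eventually_elim (auto simp: \<rho> F[OF i(1)])
    then show "lifts \<beta> \<gamma> (\<lambda>s. \<rho> (\<gamma> s)) t"
      by (rule lifts_cong[OF lift always_eventually[OF allI[OF refl]]])
  qed
  ultimately show ?thesis
    unfolding sl_integrable_def using P(1) by (intro exI[of _ \<rho>]) (auto simp: \<rho>_def)
qed

lemma sl_integrable_UNIV: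
  fixes \<beta> :: "'r::finite cmat \<Rightarrow> 'n::finite cmat"
  assumes "invariant_conn \<beta>"
  shows "sl_integrable \<beta> UNIV"
proof -
  \<comment> \<open>\<beta> is generalised because the induction step also uses the hypothesis for
    the dual representation.\<close>
  have "sl_integrable \<beta> (insert k S)" if "finite S" "k \<notin> S" "invariant_conn \<beta>" for k S
    and \<beta> :: "'r cmat \<Rightarrow> 'n cmat"
    using that
  proof (induction S arbitrary: \<beta> rule: finite_induct)
    case empty
    then show ?case by (simp add: sl_integrable_singleton)
  next
    case (insert a S)
    have "sl_integrable \<beta> (insert a (insert k S))"
      by (rule sl_integrable_insert[where k = k])
         (use insert.hyps insert.prems insert.IH invariant_conn_dual in auto)
    then show ?case by (simp add: insert_commute)
  qed
  \<comment> \<open>\<open>undefined\<close> is just some index at which the induction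
    starts.\<close>
  from this[of "UNIV - {undefined}" undefined \<beta>] assms show ?thesis
    by (simp add: insert_absorb)
qed

text \<open>\<sigma> is the transposed solution of the dual equation, so the inverse of \<rho> is
  polynomial as well. Its derivative formula is the equation that the isomorphism will have to
  satisfy.\<close>

lemma polynomial_integration:
  fixes \<beta> :: "'r::finite cmat \<Rightarrow> 'n::finite cmat"
  assumes conn: "invariant_conn \<beta>"
  obtains \<rho> \<sigma> where "\<And>i j. (\<lambda>g. \<rho> g $ i $ j) \<in> polyfn" "\<And>i j. (\<lambda>g. \<sigma> g $ i $ j) \<in> polyfn"
    and "\<And>g. det g = 1 \<Longrightarrow> \<rho> g ** \<sigma> g = mat 1" "\<And>g. det g = 1 \<Longrightarrow> \<sigma> g ** \<rho> g = mat 1"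
    and "\<And>g. det g = 1 \<Longrightarrow> adm \<beta> g (\<rho> g)"
    and "\<And>\<gamma> B t. \<forall>\<^sub>F s in nhds t. det (\<gamma> s) = 1 \<Longrightarrow> mderiv \<gamma> (\<gamma> t ** B) t \<Longrightarrow>
       mderiv (\<lambda>s. \<sigma> (\<gamma> s)) (- (\<beta> B ** \<sigma> (\<gamma> t))) t"
proof -
  obtain \<rho> where \<rho>: "\<And>i j. (\<lambda>g. \<rho> g $ i $ j) \<in> polyfn" "\<rho> (mat 1) = mat 1"
    "integrates_on \<beta> (SLs UNIV) \<rho>"
    using sl_integrable_UNIV[OF conn] unfolding sl_integrable_def by blast
  obtain \<tau> where \<tau>: "\<And>i j. (\<lambda>g. \<tau> g $ i $ j) \<in> polyfn" "\<tau> (mat 1) = mat 1"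
    "integrates_on (dual_conn \<beta>) (SLs UNIV) \<tau>"
    using sl_integrable_UNIV[OF invariant_conn_dual[OF conn]] unfolding sl_integrable_def by blast
  define \<sigma> where "\<sigma> g = transpose (\<tau> g)" for g
  have SL: "g \<in> SLs UNIV \<longleftrightarrow> det g = 1" for g :: "'r cmat" by (simp add: SLs_def)
  have right_inv: "\<rho> g ** \<sigma> g = mat 1" if g: "det g = 1" for g
  proof -
    obtain \<gamma> Z where Z: "finite Z" "0 \<notin> Z" "1 \<notin> Z" and \<gamma>01: "\<gamma> 0 = mat 1" "\<gamma> 1 = g"
      and \<gamma>: "\<And>z. z \<notin> Z \<Longrightarrow> \<gamma> z \<in> SLs UNIV" "\<And>z. z \<notin> Z \<Longrightarrow> \<exists>D. mderiv \<gamma> D z"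
      by (rule connecting_curve[OF UNIV_I g[folded SL]]) blast
    show ?thesis
      using integrates_dual_inverse[OF \<rho>(3) \<tau>(3) Z \<gamma>] by (simp add: \<gamma>01 \<rho>(2) \<tau>(2) \<sigma>_def transpose_mat)
  qed
  then have left_inv: "\<sigma> g ** \<rho> g = mat 1" if "det g = 1" for g
    using that matrix_left_right_inverse by blast
  have adm: "adm \<beta> g (\<rho> g)" if g: "det g = 1" for g
  proof -
    have "lifts \<beta> (\<lambda>s. g) (\<lambda>s. \<rho> g) 0"
      using g mderiv_const by (intro integrates_onD[OF \<rho>(3)]) (auto simp: SL)
    then show ?thesis by (simp add: lifts_def)
  qed
  have deriv: "mderiv (\<lambda>s. \<sigma> (\<gamma> s)) (- (\<beta> B ** \<sigma> (\<gamma> t))) t"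
    if ev: "\<forall>\<^sub>F s in nhds t. det (\<gamma> s) = 1" and B: "mderiv \<gamma> (\<gamma> t ** B) t" for \<gamma> B t
  proof -
    have "lifts \<beta> \<gamma> (\<lambda>s. \<rho> (\<gamma> s)) t" "lifts (dual_conn \<beta>) \<gamma> (\<lambda>s. \<tau> (\<gamma> s)) t"
      using ev B by (auto intro!: integrates_onD[OF \<rho>(3)] integrates_onD[OF \<tau>(3)] simp: SL)
    from mderiv_dual[OF this B] show ?thesis by (simp add: \<sigma>_def)
  qed
  have \<sigma>: "(\<lambda>g. \<sigma> g $ i $ j) \<in> polyfn" for i j
    using \<tau>(1)[of j i] by (simp add: \<sigma>_def transpose_def)
  show thesis
    by (rule that[of \<rho> \<sigma>, OF \<rho>(1) \<sigma> right_inv left_inv adm deriv])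
qed

subsection \<open>The derivative of the determinant and pullback of forms\<close>

text \<open>A permutation other than the identity moves at least two indices, j and p j. The product
  rule removes only one factor, so a vanishing off-diagonal entry of the identity remains and only
  the diagonal term contributes.\<close>

lemma det_has_derivative_trace:
  fixes A :: "'r::finite cmat"
  shows "((\<lambda>t. det (mat 1 + msc t A)) has_field_derivative trace A) (at 0)"
proof -
  define D where "D p = (\<Sum>i\<in>UNIV. A $ i $ p i * (\<Prod>j\<in>UNIV - {i}. (mat 1 + msc 0 A) $ j $ p j))"
    for p :: "'r \<Rightarrow> 'r"
  have "((\<lambda>t. (mat 1 + msc t A) $ i $ j) has_field_derivative A $ i $ j) (at 0)" for i j
    by (auto intro!: derivative_eq_intros)
  then have "((\<lambda>t. \<Prod>i\<in>UNIV. (mat 1 + msc t A) $ i $ p i) has_field_derivative D p) (at 0)" for p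
    unfolding D_def by (intro has_field_derivative_prod) auto
  then have "((\<lambda>t. det (mat 1 + msc t A)) has_field_derivative
      (\<Sum>p | p permutes UNIV. of_int (sign p) * D p)) (at 0)"
    unfolding det_def by (intro DERIV_sum DERIV_cmult) auto
  moreover have D: "of_int (sign p) * D p = (if p = id then trace A else 0)" if p: "p permutes UNIV" for p
  proof (cases "p = id")
    case True
    have "(\<Prod>j\<in>UNIV - {i}. (mat 1 + msc 0 A) $ j $ j) = 1" for i :: 'r
      by (intro prod.neutral) (auto simp: mat_def)
    then show ?thesis using True by (simp add: D_def sign_id trace_def)
  next
    case False
    then obtain j where j: "p j \<noteq> j" by (auto simp: fun_eq_iff)
    then have pj: "p (p j) \<noteq> p j" using permutes_inj[OF p] by (auto dest: injD)
    have "(\<Prod>j\<in>UNIV - {i}. (mat 1 + msc 0 A) $ j $ p j) = 0" for i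
    proof (cases "i = j")
      case True
      then show ?thesis using j pj
        by (intro prod_zero bexI[of _ "p j"]) (auto simp: mat_def)
    next
      case False
      then show ?thesis using j
        by (intro prod_zero bexI[of _ j]) (auto simp: mat_def)
    qed
    then have "D p = 0" by (simp only: D_def mult_zero_right sum.neutral_const)
    then show ?thesis using False by simp
  qed
  have "(\<Sum>p | p permutes (UNIV :: 'r set). of_int (sign p) * D p) =
      (\<Sum>p | p permutes (UNIV :: 'r set). if p = id then trace A else 0)"
    by (intro sum.cong refl D) simp
  then have "(\<Sum>p | p permutes (UNIV :: 'r set). of_int (sign p) * D p) = trace A"
    by (simp add: permutes_id finite_permutations)
  ultimately show ?thesis by simp
qed

lemma det_line:
  fixes A g :: "'r::finite cmat"
  shows "((\<lambda>t. det (g + msc t (g ** A))) has_field_derivative det g * trace A) (at 0)"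
proof -
  have "det (g + msc t (g ** A)) = det g * det (mat 1 + msc t A)" for t
    by (simp add: mat_algebra flip: det_mul)
  then show ?thesis using DERIV_cmult[OF det_has_derivative_trace] by simp
qed

definition scalar1 :: "complex \<Rightarrow> 1 cmat" where
  "scalar1 c = (\<chi> i j. c)"

lemma scalar1_nth [simp]: "scalar1 c $ i $ j = c"
  by (simp add: scalar1_def)

lemma scalar1_eq: "scalar1 (A $ 1 $ 1) = A"
  by (simp add: vec_eq_iff forall_1)

lemma mult_1_nth: "((A :: 1 cmat) ** (B :: 1 cmat)) $ i $ j = A $ 1 $ 1 * B $ 1 $ 1"
proof -
  have ij: "i = 1" "j = 1" by (rule num1_eq1)+
  show ?thesis unfolding ij by (simp add: matrix_matrix_mult_def sum_1)
qed

lemma det_scalar1 [simp]: "det (scalar1 c) = c"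
  by (simp add: det_1)

lemma det_pullback_eq: "det_pullback \<alpha> A = \<alpha> (scalar1 (trace A))"
  unfolding det_pullback_def scalar1_def
  by (simp add: DERIV_imp_deriv[OF det_has_derivative_trace])

lemma trace_msc: "trace (msc c A) = c * trace A"
  by (simp add: trace_def sum_distrib_left)

lemma invariant_conn_pullback:
  assumes conn: "invariant_conn (\<alpha> :: 1 cmat \<Rightarrow> 'n::finite cmat)"
  shows "invariant_conn (det_pullback \<alpha> :: 'r::finite cmat \<Rightarrow> 'n cmat)"
  unfolding invariant_conn_def
proof (intro conjI allI)
  fix A B :: "'r cmat" and c
  have "scalar1 (trace (A + B)) = scalar1 (trace A) + scalar1 (trace B)"
    by (simp add: vec_eq_iff trace_add)
  then show "det_pullback \<alpha> (A + B) = det_pullback \<alpha> A + det_pullback \<alpha> B"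
    by (simp add: det_pullback_eq conn_add[OF conn])
  have "scalar1 (trace (msc c A)) = msc c (scalar1 (trace A))"
    by (simp add: vec_eq_iff trace_msc)
  then show "det_pullback \<alpha> (msc c A) = msc c (det_pullback \<alpha> A)"
    by (simp add: det_pullback_eq conn_msc[OF conn])
  let ?X = "scalar1 (trace A)" and ?Y = "scalar1 (trace B)"
  have "scalar1 (trace (A ** B - B ** A)) = ?X ** ?Y - ?Y ** ?X"
    by (simp add: vec_eq_iff trace_sub trace_mul_sym[of A B] mult_1_nth)
  then show "det_pullback \<alpha> (A ** B - B ** A) =
      det_pullback \<alpha> A ** det_pullback \<alpha> B - det_pullback \<alpha> B ** det_pullback \<alpha> A"
    by (simp add: det_pullback_eq conn_bracket[OF conn])
qed

lemma regular_fn_compose: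
  assumes "f \<in> regular_fn" "function_ring R" "\<And>i j. (\<lambda>x. \<phi> x $ i $ j) \<in> R"
    "(\<lambda>x. inverse (det (\<phi> x))) \<in> R"
  shows "(\<lambda>x. f (\<phi> x)) \<in> R"
  using assms(1) by induction (auto intro: function_ringD[OF assms(2)] assms(3,4))

text \<open>det maps the field of \<open>A\<close> to the field of \<open>trace A\<close>: by the
  chain rule both sides are the derivative of f at det g times det g * trace A.\<close>

lemma inv_vf_comp_det:
  fixes g A :: "'r::finite cmat"
  assumes f: "f \<in> regular_fn" and g: "det g \<noteq> 0"
  shows "inv_vf A (\<lambda>g. f (scalar1 (det g))) g = inv_vf (scalar1 (trace A)) f (scalar1 (det g))"
proof -
  let ?R = "{f::complex \<Rightarrow> complex. f field_differentiable at (det g)}"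
  have "(\<lambda>c. f (scalar1 c)) \<in> ?R"
    by (rule regular_fn_compose[OF f function_ring_field_differentiable])
       (auto intro!: field_differentiable_inverse g simp: field_differentiable_ident[unfolded id_def])
  then obtain F' where F': "((\<lambda>c. f (scalar1 c)) has_field_derivative F') (at (det g))"
    by (auto simp: field_differentiable_def)
  have "((\<lambda>t. f (scalar1 (det (g + msc t (g ** A))))) has_field_derivative F' * (det g * trace A)) (at 0)"
    using F' by (intro DERIV_chain2[of "\<lambda>c. f (scalar1 c)" _ "\<lambda>t. det (g + msc t (g ** A))"] det_line) simp
  then have 1: "inv_vf A (\<lambda>g. f (scalar1 (det g))) g = F' * (det g * trace A)"
    unfolding inv_vf_def by (rule DERIV_imp_deriv)
  have "((\<lambda>t. f (scalar1 (det g + t * (det g * trace A)))) has_field_derivative F' * (det g * trace A)) (at 0)"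
    using F' by (intro DERIV_chain2[of "\<lambda>c. f (scalar1 c)" _ "\<lambda>t. det g + t * (det g * trace A)"])
      (auto intro!: derivative_eq_intros)
  moreover have "scalar1 (det g) + msc t (scalar1 (det g) ** scalar1 (trace A)) =
      scalar1 (det g + t * (det g * trace A))" for t
    by (simp add: vec_eq_iff mult_1_nth)
  ultimately have 2: "inv_vf (scalar1 (trace A)) f (scalar1 (det g)) = F' * (det g * trace A)"
    unfolding inv_vf_def by (simp add: DERIV_imp_deriv)
  show ?thesis using 1 2 by simp
qed

section \<open>Isomorphisms of D-modules and the determinant\<close>

lemma D_isoI:
  fixes \<alpha> \<beta> :: "'r::finite cmat \<Rightarrow> 'n::finite cmat"
  assumes "\<And>k l. \<Phi> k l \<in> regular_fn" "\<And>k l. \<Psi> k l \<in> regular_fn"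
    and "\<And>g. g \<in> GL \<Longrightarrow> (\<chi> k l. \<Phi> k l g) ** (\<chi> k l. \<Psi> k l g) = mat 1"
    and "\<And>g. g \<in> GL \<Longrightarrow> (\<chi> k l. \<Psi> k l g) ** (\<chi> k l. \<Phi> k l g) = mat 1"
    and "\<And>A g. g \<in> GL \<Longrightarrow> (\<chi> k l. inv_vf A (\<Phi> k l) g) + \<beta> A ** (\<chi> k l. \<Phi> k l g) =
        (\<chi> k l. \<Phi> k l g) ** \<alpha> A"
  shows "D_iso \<alpha> \<beta>"
  unfolding D_iso_def using assms by (intro exI[of _ \<Phi>] exI[of _ \<Psi>]) blast

lemma D_isoE:
  fixes \<alpha> \<beta> :: "'r::finite cmat \<Rightarrow> 'n::finite cmat"
  assumes "D_iso \<alpha> \<beta>"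
  obtains \<Phi> \<Psi> where "\<And>k l. \<Phi> k l \<in> regular_fn" "\<And>k l. \<Psi> k l \<in> regular_fn"
    and "\<And>g. g \<in> GL \<Longrightarrow> (\<chi> k l. \<Phi> k l g) ** (\<chi> k l. \<Psi> k l g) = mat 1"
    and "\<And>g. g \<in> GL \<Longrightarrow> (\<chi> k l. \<Psi> k l g) ** (\<chi> k l. \<Phi> k l g) = mat 1"
    and "\<And>A g. g \<in> GL \<Longrightarrow> (\<chi> k l. inv_vf A (\<Phi> k l) g) + \<beta> A ** (\<chi> k l. \<Phi> k l g) =
        (\<chi> k l. \<Phi> k l g) ** \<alpha> A"
proof -
  obtain \<Phi> \<Psi> where *: "(\<forall>k l. \<Phi> k l \<in> regular_fn \<and> \<Psi> k l \<in> regular_fn) \<and>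
      (\<forall>g\<in>GL. (\<chi> k l. \<Phi> k l g) ** (\<chi> k l. \<Psi> k l g) = mat 1 \<and>
        (\<chi> k l. \<Psi> k l g) ** (\<chi> k l. \<Phi> k l g) = mat 1) \<and>
      (\<forall>A. \<forall>g\<in>GL. (\<chi> k l. inv_vf A (\<Phi> k l) g) + \<beta> A ** (\<chi> k l. \<Phi> k l g) =
        (\<chi> k l. \<Phi> k l g) ** \<alpha> A)"
    using assms unfolding D_iso_def by (elim exE)
  show thesis by (rule that[of \<Phi> \<Psi>]) (simp_all only: *)
qed

lemma D_iso_pullback:
  fixes \<alpha> \<beta> :: "1 cmat \<Rightarrow> 'n::finite cmat"
  assumes "D_iso \<alpha> \<beta>"
  shows "D_iso (det_pullback \<alpha> :: 'r::finite cmat \<Rightarrow> 'n cmat) (det_pullback \<beta>)"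
proof -
  obtain \<Phi> \<Psi> where reg: "\<And>k l. \<Phi> k l \<in> regular_fn" "\<And>k l. \<Psi> k l \<in> regular_fn"
    and inv: "\<And>g. g \<in> GL \<Longrightarrow> (\<chi> k l. \<Phi> k l g) ** (\<chi> k l. \<Psi> k l g) = mat 1"
      "\<And>g. g \<in> GL \<Longrightarrow> (\<chi> k l. \<Psi> k l g) ** (\<chi> k l. \<Phi> k l g) = mat 1"
    and eq: "\<And>A g. g \<in> GL \<Longrightarrow> (\<chi> k l. inv_vf A (\<Phi> k l) g) + \<beta> A ** (\<chi> k l. \<Phi> k l g) =
        (\<chi> k l. \<Phi> k l g) ** \<alpha> A"
    by (rule D_isoE[OF assms]) blast
  have GL: "scalar1 (det g) \<in> GL" if "g \<in> GL" for g :: "'r cmat"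
    using that by (simp add: GL_def)
  have comp: "(\<lambda>g::'r cmat. f (scalar1 (det g))) \<in> regular_fn" if "f \<in> regular_fn" for f
    by (rule regular_fn_compose[OF that function_ring_regular_fn])
       (simp_all add: regular_fn.intros function_ring_det function_ring_regular_fn)
  show ?thesis
  proof (rule D_isoI[where \<Phi> = "\<lambda>k l g. \<Phi> k l (scalar1 (det g))" and \<Psi> = "\<lambda>k l g. \<Psi> k l (scalar1 (det g))"])
    show "(\<lambda>g::'r cmat. \<Phi> k l (scalar1 (det g))) \<in> regular_fn"
      "(\<lambda>g::'r cmat. \<Psi> k l (scalar1 (det g))) \<in> regular_fn" for k l
      by (intro comp reg)+
  next
    fix A g :: "'r cmat" assume g: "g \<in> GL"
    show "(\<chi> k l. inv_vf A (\<lambda>g. \<Phi> k l (scalar1 (det g))) g) +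
        det_pullback \<beta> A ** (\<chi> k l. \<Phi> k l (scalar1 (det g))) =
        (\<chi> k l. \<Phi> k l (scalar1 (det g))) ** det_pullback \<alpha> A"
      using eq[OF GL[OF g], of "scalar1 (trace A)"] g
      by (simp add: det_pullback_eq inv_vf_comp_det[OF reg(1)] GL_def)
  qed (use inv GL in auto)
qed

text \<open>Restriction along the section \<open>c \<mapsto> diag(c, 1, \<dots>, 1)\<close> of \<open>det\<close>.\<close>

lemma D_iso_of_pullback:
  fixes \<alpha> \<beta> :: "1 cmat \<Rightarrow> 'n::finite cmat"
  assumes "D_iso (det_pullback \<alpha> :: 'r::finite cmat \<Rightarrow> 'n cmat) (det_pullback \<beta>)"
  shows "D_iso \<alpha> \<beta>"
proof -
  obtain \<Phi> \<Psi> :: "'n \<Rightarrow> 'n \<Rightarrow> 'r cmat \<Rightarrow> complex"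
    where reg: "\<And>k l. \<Phi> k l \<in> regular_fn" "\<And>k l. \<Psi> k l \<in> regular_fn"
    and inv: "\<And>g. g \<in> GL \<Longrightarrow> (\<chi> k l. \<Phi> k l g) ** (\<chi> k l. \<Psi> k l g) = mat 1"
      "\<And>g. g \<in> GL \<Longrightarrow> (\<chi> k l. \<Psi> k l g) ** (\<chi> k l. \<Phi> k l g) = mat 1"
    and eq: "\<And>A g. g \<in> GL \<Longrightarrow> (\<chi> k l. inv_vf A (\<Phi> k l) g) + det_pullback \<beta> A ** (\<chi> k l. \<Phi> k l g) =
        (\<chi> k l. \<Phi> k l g) ** det_pullback \<alpha> A"
    by (rule D_isoE[OF assms]) blast
  define k :: 'r where "k = undefined"
  define s :: "1 cmat \<Rightarrow> 'r cmat" where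
    "s c = (\<chi> i j. if i = j then (if i = k then c $ 1 $ 1 else 1) else 0)" for c
  \<comment> \<open>The differential of the section \<open>s\<close> at the identity; its trace is
    the entry of \<open>A\<close>, so pulled-back forms take their original values on it.\<close>
  define E where "E A = msc (A $ 1 $ 1) (munit k k)" for A :: "1 cmat"
  have det_s: "det (s c) = det c" for c
    by (subst det_diagonal) (auto simp: s_def det_1)
  then have GL: "s c \<in> GL" if "c \<in> GL" for c
    using that by (simp add: GL_def)
  have "(\<lambda>c. s c $ i $ j) \<in> regular_fn" for i j
    by (cases "i = j"; cases "i = k") (auto simp: s_def intro: regular_fn.intros)
  then have comp: "(\<lambda>c. f (s c)) \<in> regular_fn" if "f \<in> regular_fn" for f
    by (intro regular_fn_compose[OF that function_ring_regular_fn]) (auto simp: det_s intro: regular_fn.intros)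
  \<comment> \<open>s(c (1 + t A)) = s(c) (1 + t E A): the section carries left-invariant fields to
    left-invariant fields.\<close>
  have "s (c + msc t (c ** A)) = s c + msc t (s c ** E A)" for c t A
  proof -
    have "(s c ** munit k k) $ i $ j = (if i = k \<and> j = k then c $ 1 $ 1 else 0)" for i j
      by (auto simp: matrix_matrix_mult_def s_def mult_delta_left intro!: sum.neutral)
    then show ?thesis
      by (auto simp: vec_eq_iff E_def msc_mult_right s_def mult_1_nth)
  qed
  then have vf: "inv_vf A (\<lambda>c. f (s c)) c = inv_vf (E A) f (s c)" for f A c
    by (simp add: inv_vf_def)
  have "trace (E A) = A $ 1 $ 1" for A
    by (simp add: E_def trace_def mult_delta_right)
  then have pull: "det_pullback \<gamma> (E A) = \<gamma> A" for \<gamma> :: "1 cmat \<Rightarrow> 'n cmat" and A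
    by (simp add: det_pullback_eq scalar1_eq)
  show ?thesis
  proof (rule D_isoI[where \<Phi> = "\<lambda>k l g. \<Phi> k l (s g)" and \<Psi> = "\<lambda>k l g. \<Psi> k l (s g)"])
    show "(\<lambda>c. \<Phi> k l (s c)) \<in> regular_fn" "(\<lambda>c. \<Psi> k l (s c)) \<in> regular_fn" for k l
      by (intro comp reg)+
  next
    fix A c :: "1 cmat" assume c: "c \<in> GL"
    show "(\<chi> k l. inv_vf A (\<lambda>c. \<Phi> k l (s c)) c) + \<beta> A ** (\<chi> k l. \<Phi> k l (s c)) =
        (\<chi> k l. \<Phi> k l (s c)) ** \<alpha> A"
      using eq[OF GL[OF c], of "E A"] by (simp add: pull vf)
  qed (use inv GL in auto)
qed

text \<open>Along g (1 + t A) the logarithmic derivative of h is B = A - tr(A) h^-1 E h. Hence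
  \<Phi> = \<sigma>(h g) satisfies X_A \<Phi> + \<beta>(A) \<Phi> = tr(A) \<beta>(h^-1 E h) \<Phi>,
  and admissibility of \<rho>(h g) rewrites the right side as \<Phi> tr(A) \<beta>(E), which is
  \<Phi> times the pulled-back form.\<close>

lemma pullback_surjective:
  fixes \<beta> :: "'r::finite cmat \<Rightarrow> 'n::finite cmat"
  assumes conn: "invariant_conn \<beta>"
  shows "\<exists>\<alpha>. invariant_conn \<alpha> \<and> D_iso (det_pullback \<alpha>) \<beta>"
proof -
  define k :: 'r where "k = undefined"
  define E :: "'r cmat" where "E = munit k k"
  define \<alpha> where "\<alpha> c = msc (c $ 1 $ 1) (\<beta> E)" for c :: "1 cmat"
  \<comment> \<open>Flatness holds because all values are multiples of one matrix and 1 x 1 matrices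
    commute.\<close>
  have "invariant_conn \<alpha>"
    unfolding invariant_conn_def \<alpha>_def by (simp add: msc_add_left mult_1_nth mat_algebra mult.commute)
  moreover have "D_iso (det_pullback \<alpha>) \<beta>"
  proof -
    obtain \<rho> \<sigma> where poly: "\<And>i j. (\<lambda>g. \<rho> g $ i $ j) \<in> polyfn" "\<And>i j. (\<lambda>g. \<sigma> g $ i $ j) \<in> polyfn"
      and inv: "\<And>g. det g = 1 \<Longrightarrow> \<rho> g ** \<sigma> g = mat 1" "\<And>g. det g = 1 \<Longrightarrow> \<sigma> g ** \<rho> g = mat 1"
      and adm: "\<And>g. det g = 1 \<Longrightarrow> adm \<beta> g (\<rho> g)"
      and deriv: "\<And>\<gamma> B t. \<forall>\<^sub>F s in nhds t. det (\<gamma> s) = 1 \<Longrightarrow> mderiv \<gamma> (\<gamma> t ** B) t \<Longrightarrow>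
         mderiv (\<lambda>s. \<sigma> (\<gamma> s)) (- (\<beta> B ** \<sigma> (\<gamma> t))) t"
      by (rule polynomial_integration[OF conn]) blast
    define S :: "complex \<Rightarrow> 'r cmat" where "S c = mat 1 + msc (inverse c - 1) E" for c
    define h :: "'r cmat \<Rightarrow> 'r cmat" where "h g = S (det g) ** g" for g
    have EE: "E ** E = E" by (simp add: E_def munit_mult)
    have "det (S c) = inverse c" for c
    proof -
      have "det (S c) = (\<Prod>i\<in>UNIV. S c $ i $ i)"
        by (rule det_diagonal) (auto simp: S_def E_def mat_def)
      also have "\<dots> = (\<Prod>i\<in>UNIV. if i = k then inverse c else 1)"
        by (intro prod.cong refl) (auto simp: S_def E_def mat_def)
      finally show ?thesis by simp
    qed
    then have det_h: "det (h g) = 1" if "det g \<noteq> 0" for g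
      using that by (simp add: h_def det_mul)
    have reg: "(\<lambda>g. f (h g)) \<in> regular_fn" if "f \<in> polyfn" for f
    proof (rule polyfn_compose[OF that function_ring_regular_fn])
      note R = function_ring_regular_fn
      have "(\<lambda>g. S (det g) $ i $ j) \<in> regular_fn" for i j
        by (simp add: S_def function_ringD[OF R] function_ring_diff[OF R] regular_fn.intros)
      then show "(\<lambda>g. h g $ i $ j) \<in> regular_fn" for i j
        unfolding h_def by (intro function_ring_matrix_mult[OF R] regular_fn.intros)
    qed
    show ?thesis
    proof (rule D_isoI[where \<Phi> = "\<lambda>i j g. \<sigma> (h g) $ i $ j" and \<Psi> = "\<lambda>i j g. \<rho> (h g) $ i $ j"])
      show "(\<lambda>g. \<sigma> (h g) $ i $ j) \<in> regular_fn" "(\<lambda>g. \<rho> (h g) $ i $ j) \<in> regular_fn" for i j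
        by (intro reg[OF poly(2)] reg[OF poly(1)])+
    next
      fix A g :: "'r cmat" assume "g \<in> GL"
      then have g: "det g \<noteq> 0" by (simp add: GL_def)
      define G where "G t = g + msc t (g ** A)" for t
      define c where "c t = det (G t)" for t
      have G0: "G 0 = g" "c 0 = det g" by (simp_all add: G_def c_def)
      define W where "W = matrix_inv (h g) ** E ** h g"
      define B where "B = A - msc (trace A) W"
      note hg = det_h[OF g]
      have hinv: "h g ** matrix_inv (h g) = mat 1"
        using hg by (simp add: invertible_mult_matrix_inv invertible_det_nz)
      have hW: "h g ** W = E ** h g"
        by (simp add: W_def matrix_mul_assoc hinv)
      have dc: "(c has_field_derivative det g * trace A) (at 0)"
        unfolding c_def G_def by (rule det_line)
      then have "isCont c 0" by (rule DERIV_isCont)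
      then have "\<forall>\<^sub>F t in nhds 0. c t \<noteq> 0"
        using g G0 by (simp add: eventually_nhds_conv_at isCont_def tendsto_imp_eventually_ne)
      then have ev: "\<forall>\<^sub>F t in nhds 0. det (h (G t)) = 1"
        by eventually_elim (simp add: c_def det_h)
      have "((\<lambda>t. inverse (c t) - 1) has_field_derivative - (trace A * inverse (det g))) (at 0)"
        using dc g G0 by (auto intro!: derivative_eq_intros simp: field_simps power2_eq_square)
      from mderiv_add[OF mderiv_const[of "mat 1"] mderiv_msc[OF this mderiv_const[of E]]]
      have dS: "mderiv (\<lambda>t. S (c t)) (msc (- (trace A * inverse (det g))) E) 0"
        by (simp add: S_def)
      have "mderiv G (0 + (msc 1 (g ** A) + msc 0 0)) 0"
        unfolding G_def by (intro mderiv_add mderiv_msc mderiv_const DERIV_ident)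
      then have dG: "mderiv G (g ** A) 0" by simp
      have "mderiv (\<lambda>t. h (G t)) (msc (- (trace A * inverse (det g))) E ** g + S (det g) ** (g ** A)) 0"
        using mderiv_mult[OF dS dG] by (simp add: h_def c_def G0(1))
      moreover have "msc (- (trace A * inverse (det g))) E ** g + S (det g) ** (g ** A) = h g ** B"
      proof -
        \<comment> \<open>\<open>E\<close> absorbs S(det g) up to the scalar 1 / det g, so the
          derivative of the first factor of h becomes - tr(A) E h = - tr(A) h W.\<close>
        have "E ** h g = msc (inverse (det g)) (E ** g)"
          by (simp add: h_def S_def mat_algebra EE) (simp add: vec_eq_iff algebra_simps)
        then have "h g ** B = h g ** A - msc (trace A * inverse (det g)) (E ** g)"
          by (simp add: B_def mat_algebra hW)
        then show ?thesis
          by (simp add: h_def matrix_mul_assoc msc_mult_left) (simp add: vec_eq_iff)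
      qed
      ultimately have "mderiv (\<lambda>t. \<sigma> (h (G t))) (- (\<beta> B ** \<sigma> (h g))) 0"
        using deriv[OF ev, of B] by (simp add: G0)
      then have "inv_vf A (\<lambda>g. \<sigma> (h g) $ i $ j) g = (- (\<beta> B ** \<sigma> (h g))) $ i $ j" for i j
        unfolding inv_vf_def G_def[symmetric] by (intro DERIV_imp_deriv mderivD)
      then have vf: "(\<chi> i j. inv_vf A (\<lambda>g. \<sigma> (h g) $ i $ j) g) = - (\<beta> B ** \<sigma> (h g))"
        by (simp add: vec_eq_iff)
      have "\<rho> (h g) ** \<beta> W = \<beta> E ** \<rho> (h g)"
        using adm[OF hg] hW by (simp add: adm_def)
      then have "(\<sigma> (h g) ** \<rho> (h g)) ** \<beta> W ** \<sigma> (h g) = \<sigma> (h g) ** \<beta> E ** (\<rho> (h g) ** \<sigma> (h g))"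
        by (metis matrix_mul_assoc)
      then have "\<beta> W ** \<sigma> (h g) = \<sigma> (h g) ** \<beta> E"
        by (simp add: inv hg)
      then show "(\<chi> i j. inv_vf A (\<lambda>g. \<sigma> (h g) $ i $ j) g) + \<beta> A ** (\<chi> i j. \<sigma> (h g) $ i $ j) =
          (\<chi> i j. \<sigma> (h g) $ i $ j) ** det_pullback \<alpha> A"
        by (simp add: vf det_pullback_eq \<alpha>_def B_def conn_diff[OF conn] conn_msc[OF conn] mat_algebra)
    qed (simp_all add: GL_def inv det_h)
  qed
  ultimately show ?thesis by blast
qed

theorem theorem4p1:
  shows
   "(\<forall>\<alpha> :: 1 cmat \<Rightarrow> ('n::finite) cmat. invariant_conn \<alpha> \<longrightarrow>
        invariant_conn (det_pullback \<alpha> :: ('r::finite) cmat \<Rightarrow> 'n cmat)) \<and>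
    (\<forall>\<alpha> \<beta> :: 1 cmat \<Rightarrow> 'n cmat. invariant_conn \<alpha> \<longrightarrow> invariant_conn \<beta> \<longrightarrow>
        D_iso \<alpha> \<beta> \<longrightarrow> D_iso (det_pullback \<alpha> :: 'r cmat \<Rightarrow> 'n cmat) (det_pullback \<beta>)) \<and>
    (\<forall>\<alpha> \<beta> :: 1 cmat \<Rightarrow> 'n cmat. invariant_conn \<alpha> \<longrightarrow> invariant_conn \<beta> \<longrightarrow>
        D_iso (det_pullback \<alpha> :: 'r cmat \<Rightarrow> 'n cmat) (det_pullback \<beta>) \<longrightarrow> D_iso \<alpha> \<beta>) \<and>
    (\<forall>\<beta> :: 'r cmat \<Rightarrow> 'n cmat. invariant_conn \<beta> \<longrightarrow>
        (\<exists>\<alpha> :: 1 cmat \<Rightarrow> 'n cmat. invariant_conn \<alpha> \<and> D_iso (det_pullback \<alpha>) \<beta>))"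
  by (intro conjI allI impI invariant_conn_pullback D_iso_pullback pullback_surjective)
     (assumption | rule D_iso_of_pullback)+

end
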